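(* Let $q\in\mathbb{C}$ be nonzero and not a root of $1$, and let $\mathcal{U}$ be the $\mathbb{Z}_2$-graded Hopf algebra $U_q(osp(1,2))$ with generators $k^{\pm1},e,f$ described in the context. The group-like elements of $\mathcal{U}$ are exactly $k^m$, $m\in\mathbb{Z}$. For $m,n\in\mathbb{Z}$ let $P(m,n)$ denote the subspace of all $(k^m,k^n)$-primitive elements of $\mathcal{U}$. Then: (1) If $m=n$, then $P(m,n)=0$. (2) If $n-m\neq 0,1$, then $P(m,n)=\mathbb{C}(k^m-k^n)$. (3) $P(0,1)=\mathbb{C}e\oplus\mathbb{C}fk\oplus\mathbb{C}(k-1)$. (4) If $n-m=1$, then $P(m,n)=k^mP(0,1)$.
   Context: $\mathcal{U}$ is the $\mathbb{Z}_2$-graded associative unital $\mathbb{C}$-algebra generated by $k^{\pm1},e,f$ with relations $kk^{-1}=k^{-1}k=1$, $kek^{-1}=qe$, $kfk^{-1}=q^{-1}f$, $ef+fe=\frac{k-k^{-1}}{q-q^{-1}}$, and parity $p(k^{\pm1})=0$, $p(e)=p(f)=1$. Its $\mathbb{Z}_2$-graded Hopf algebra structure is given by $\Delta(k^{\pm1})=k^{\pm1}\otimes k^{\pm1}$, $\Delta(e)=e\otimes1+k\otimes e$, $\Delta(f)=f\otimes k^{-1}+1\otimes f$; $S(k^{\pm1})=k^{\mp1}$, $S(e)=-k^{-1}e$, $S(f)=-fk$; $\varepsilon(k^{\pm1})=1$, $\varepsilon(e)=\varepsilon(f)=0$. Here $\Delta$ is an algebra homomorphism into $\mathcal{U}\otimes\mathcal{U}$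 with the graded product $(x\otimes y)(z\otimes w)=(-1)^{p(y)p(z)}xz\otimes yw$ for homogeneous elements. For group-like elements $g,g'$ of a Hopf algebra $H$, an element $x\in H$ is called $(g,g')$-primitive if $\Delta(x)=x\otimes g+g'\otimes x$. *)

theory Defs
  imports Complex_Main "HOL-Library.Poly_Mapping" "HOL-Library.Z2" "HOL-Algebra.QuotRing"
    "HOL-Algebra.Module"
begin

section \<open>Superalgebras over the complex numbers\<close>

text \<open>
  A superalgebra is stored as the algebra record of HOL-Algebra together with the projections
  onto the even part (index 0) and the odd part (index 1). The index type is the field with
  two elements.
\<close>

record 'a superalg = "(complex, 'a) module" +
  hpart :: "bit \<Rightarrow> 'a \<Rightarrow> 'a"

definition koszul :: "bit \<Rightarrow> bit \<Rightarrow> complex" where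
  "koszul i j = (if i = 1 \<and> j = 1 then -1 else 1)"

text \<open>
  Quotient by a homogeneous two-sided ideal. As for \<^const>\<open>rcoset_mult\<close>, the operations are
  unions over all representatives, so that no representatives have to be chosen.
\<close>

definition quot_superalg :: "('a, 'm) superalg_scheme \<Rightarrow> 'a set \<Rightarrow> 'a set superalg" where
  "quot_superalg A I =
    \<lparr>carrier = a_rcosets\<^bsub>A\<^esub> I,
     mult = rcoset_mult A I,
     one = I +>\<^bsub>A\<^esub> \<one>\<^bsub>A\<^esub>,
     zero = I,
     add = set_add A,
     smult = (\<lambda>c X. \<Union>x\<in>X. I +>\<^bsub>A\<^esub> (c \<odot>\<^bsub>A\<^esub> x)),
     hpart = (\<lambda>i X. \<Union>x\<in>X. I +>\<^bsub>A\<^esub> hpart A i x)\<rparr>"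

abbreviation pscale :: "complex \<Rightarrow> ('a \<Rightarrow>\<^sub>0 complex) \<Rightarrow> ('a \<Rightarrow>\<^sub>0 complex)" where
  "pscale c \<equiv> Poly_Mapping.map ((*) c)"


section \<open>Tensor product with the graded multiplication\<close>

text \<open>
  The tensor product is the free vector space on pairs modulo the bilinearity relations. The
  multiplication is first given on the free vector space, as the bilinear extension of
  \<open>(x, y) (z, w) = \<Sum>i j. (-1)\<^sup>i\<^sup>j (x z\<^sub>j, y\<^sub>i w)\<close>, where \<open>y\<^sub>i\<close> and \<open>z\<^sub>j\<close> are the homogeneous components;
  for homogeneous \<open>y\<close> and \<open>z\<close> this becomes \<open>(-1)\<^bsup>p(y)p(z)\<^esup> xz \<otimes> yw\<close> in the quotient.
\<close>

definition pretensor ::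
  "('a, 'm) superalg_scheme \<Rightarrow> ('b, 'n) superalg_scheme \<Rightarrow> ('a \<times> 'b \<Rightarrow>\<^sub>0 complex) superalg" where
  "pretensor A B =
    \<lparr>carrier = {u. Poly_Mapping.keys u \<subseteq> carrier A \<times> carrier B},
     mult = (\<lambda>u v. \<Sum>(x, y)\<in>Poly_Mapping.keys u. \<Sum>(z, w)\<in>Poly_Mapping.keys v.
       \<Sum>i\<in>{0, 1}. \<Sum>j\<in>{0, 1}.
         Poly_Mapping.single (x \<otimes>\<^bsub>A\<^esub> hpart A j z, hpart B i y \<otimes>\<^bsub>B\<^esub> w)
           (koszul i j * Poly_Mapping.lookup u (x, y) * Poly_Mapping.lookup v (z, w))),
     one = Poly_Mapping.single (\<one>\<^bsub>A\<^esub>, \<one>\<^bsub>B\<^esub>) 1,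
     zero = 0,
     add = (+),
     smult = pscale,
     hpart = (\<lambda>i u. \<Sum>(x, y)\<in>Poly_Mapping.keys u. \<Sum>j\<in>{0, 1}.
       Poly_Mapping.single (hpart A j x, hpart B (i + j) y) (Poly_Mapping.lookup u (x, y)))\<rparr>"

definition bilinearity_rels ::
  "('a, 'm) superalg_scheme \<Rightarrow> ('b, 'n) superalg_scheme \<Rightarrow> ('a \<times> 'b \<Rightarrow>\<^sub>0 complex) set" where
  "bilinearity_rels A B =
     {Poly_Mapping.single (x \<oplus>\<^bsub>A\<^esub> x', y) 1 - Poly_Mapping.single (x, y) 1
        - Poly_Mapping.single (x', y) 1 | x x' y.
        x \<in> carrier A \<and> x' \<in> carrier A \<and> y \<in> carrier B}
   \<union> {Poly_Mapping.single (x, y \<oplus>\<^bsub>B\<^esub> y') 1 - Poly_Mapping.single (x, y) 1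
        - Poly_Mapping.single (x, y') 1 | x y y'.
        x \<in> carrier A \<and> y \<in> carrier B \<and> y' \<in> carrier B}
   \<union> {Poly_Mapping.single (c \<odot>\<^bsub>A\<^esub> x, y) 1 - Poly_Mapping.single (x, y) c | c x y.
        x \<in> carrier A \<and> y \<in> carrier B}
   \<union> {Poly_Mapping.single (x, c \<odot>\<^bsub>B\<^esub> y) 1 - Poly_Mapping.single (x, y) c | c x y.
        x \<in> carrier A \<and> y \<in> carrier B}"

definition bilinearity_span ::
  "('a, 'm) superalg_scheme \<Rightarrow> ('b, 'n) superalg_scheme \<Rightarrow> ('a \<times> 'b \<Rightarrow>\<^sub>0 complex) set" where
  "bilinearity_span A B = Modules.module.span pscale (bilinearity_rels A B)"

definition tensor_superalg ::
  "('a, 'm) superalg_scheme \<Rightarrow> ('b, 'n) superalg_scheme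
    \<Rightarrow> ('a \<times> 'b \<Rightarrow>\<^sub>0 complex) set superalg" where
  "tensor_superalg A B = quot_superalg (pretensor A B) (bilinearity_span A B)"

definition pure_tensor ::
  "('a, 'm) superalg_scheme \<Rightarrow> ('b, 'n) superalg_scheme \<Rightarrow> 'a \<Rightarrow> 'b
    \<Rightarrow> ('a \<times> 'b \<Rightarrow>\<^sub>0 complex) set" where
  "pure_tensor A B x y =
     bilinearity_span A B +>\<^bsub>pretensor A B\<^esub> Poly_Mapping.single (x, y) 1"


section \<open>Free superalgebras\<close>

text \<open>
  The type of words carries concatenation as its addition, so that multiplication of
  finitely supported functions on words is that of the free associative algebra.
\<close>

datatype 'g word = Word (letters: "'g list")

instantiation word :: (type) monoid_add
begin

definition zero_word :: "'a word" where
  "0 = Word []"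

definition plus_word :: "'a word \<Rightarrow> 'a word \<Rightarrow> 'a word" where
  "v + w = Word (letters v @ letters w)"

instance
  by standard (auto simp: zero_word_def plus_word_def)

end

definition word_parity :: "('g \<Rightarrow> bit) \<Rightarrow> 'g word \<Rightarrow> bit" where
  "word_parity p w = sum_list (map p (letters w))"

definition free_superalg :: "('g \<Rightarrow> bit) \<Rightarrow> ('g word \<Rightarrow>\<^sub>0 complex) superalg" where
  "free_superalg p =
    \<lparr>carrier = UNIV, mult = (*), one = 1, zero = 0, add = (+), smult = pscale,
     hpart = (\<lambda>i a. \<Sum>w | w \<in> Poly_Mapping.keys a \<and> word_parity p w = i.
       Poly_Mapping.single w (Poly_Mapping.lookup a w))\<rparr>"

definition free_gen :: "'g \<Rightarrow> ('g word \<Rightarrow>\<^sub>0 complex)" where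
  "free_gen g = Poly_Mapping.single (Word [g]) 1"

text \<open>The algebra homomorphism out of the free algebra with prescribed values on generators.\<close>

definition free_lift ::
  "('b, 'm) superalg_scheme \<Rightarrow> ('g \<Rightarrow> 'b) \<Rightarrow> ('g word \<Rightarrow>\<^sub>0 complex) \<Rightarrow> 'b" where
  "free_lift B \<phi> a =
     finsum B (\<lambda>w. Poly_Mapping.lookup a w \<odot>\<^bsub>B\<^esub>
       foldr (\<lambda>g t. \<phi> g \<otimes>\<^bsub>B\<^esub> t) (letters w) \<one>\<^bsub>B\<^esub>) (Poly_Mapping.keys a)"


section \<open>The quantum superalgebra of osp(1,2)\<close>

text \<open>\<open>Gk'\<close> is the generator that the relations make inverse to \<open>Gk\<close>.\<close>

datatype gen = Gk | Gk' | Ge | Gf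

fun gen_parity :: "gen \<Rightarrow> bit" where
  "gen_parity Gk = 0"
| "gen_parity Gk' = 0"
| "gen_parity Ge = 1"
| "gen_parity Gf = 1"

abbreviation free_osp :: "(gen word \<Rightarrow>\<^sub>0 complex) superalg" where
  "free_osp \<equiv> free_superalg gen_parity"

definition osp_rels :: "complex \<Rightarrow> (gen word \<Rightarrow>\<^sub>0 complex) set" where
  "osp_rels q = (let k = free_gen Gk; k' = free_gen Gk'; e = free_gen Ge; f = free_gen Gf in
    {k * k' - 1,
     k' * k - 1,
     k * e * k' - pscale q e,
     k * f * k' - pscale (inverse q) f,
     e * f + f * e - pscale (1 / (q - inverse q)) (k - k')})"

definition osp_ideal :: "complex \<Rightarrow> (gen word \<Rightarrow>\<^sub>0 complex) set" where
  "osp_ideal q = Idl\<^bsub>free_osp\<^esub> (osp_rels q)"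

definition Uq :: "complex \<Rightarrow> (gen word \<Rightarrow>\<^sub>0 complex) set superalg" where
  "Uq q = quot_superalg free_osp (osp_ideal q)"

definition ugen :: "complex \<Rightarrow> gen \<Rightarrow> (gen word \<Rightarrow>\<^sub>0 complex) set" where
  "ugen q g = osp_ideal q +>\<^bsub>free_osp\<^esub> free_gen g"

abbreviation UU where "UU q \<equiv> tensor_superalg (Uq q) (Uq q)"

abbreviation utensor where "utensor q \<equiv> pure_tensor (Uq q) (Uq q)"

fun comult_gen ::
  "complex \<Rightarrow> gen \<Rightarrow> ((gen word \<Rightarrow>\<^sub>0 complex) set \<times> (gen word \<Rightarrow>\<^sub>0 complex) set \<Rightarrow>\<^sub>0 complex) set"
where
  "comult_gen q Gk = utensor q (ugen q Gk) (ugen q Gk)"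
| "comult_gen q Gk' = utensor q (ugen q Gk') (ugen q Gk')"
| "comult_gen q Ge =
     utensor q (ugen q Ge) \<one>\<^bsub>Uq q\<^esub> \<oplus>\<^bsub>UU q\<^esub> utensor q (ugen q Gk) (ugen q Ge)"
| "comult_gen q Gf =
     utensor q (ugen q Gf) (ugen q Gk') \<oplus>\<^bsub>UU q\<^esub> utensor q \<one>\<^bsub>Uq q\<^esub> (ugen q Gf)"

text \<open>
  The homomorphisms below vanish on the defining ideal, hence are constant on each coset;
  \<^const>\<open>the_elem\<close> picks this constant value.
\<close>

definition comult ::
  "complex \<Rightarrow> (gen word \<Rightarrow>\<^sub>0 complex) set
    \<Rightarrow> ((gen word \<Rightarrow>\<^sub>0 complex) set \<times> (gen word \<Rightarrow>\<^sub>0 complex) set \<Rightarrow>\<^sub>0 complex) set" where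
  "comult q X = the_elem (free_lift (UU q) (comult_gen q) ` X)"

fun counit_gen :: "gen \<Rightarrow> complex" where
  "counit_gen Gk = 1"
| "counit_gen Gk' = 1"
| "counit_gen Ge = 0"
| "counit_gen Gf = 0"

definition counit :: "(gen word \<Rightarrow>\<^sub>0 complex) set \<Rightarrow> complex" where
  "counit X = the_elem ((\<lambda>a. \<Sum>w\<in>Poly_Mapping.keys a.
     Poly_Mapping.lookup a w * prod_list (map counit_gen (letters w))) ` X)"


section \<open>Group-like and skew-primitive elements\<close>

definition grouplike :: "complex \<Rightarrow> (gen word \<Rightarrow>\<^sub>0 complex) set \<Rightarrow> bool" where
  "grouplike q g \<longleftrightarrow> g \<in> carrier (Uq q) \<and> comult q g = utensor q g g \<and> counit g = 1"

definition skew_primitives ::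
  "complex \<Rightarrow> (gen word \<Rightarrow>\<^sub>0 complex) set \<Rightarrow> (gen word \<Rightarrow>\<^sub>0 complex) set
    \<Rightarrow> (gen word \<Rightarrow>\<^sub>0 complex) set set" where
  "skew_primitives q g g' =
     {x \<in> carrier (Uq q). comult q x = utensor q x g \<oplus>\<^bsub>UU q\<^esub> utensor q g' x}"

definition kpow :: "complex \<Rightarrow> int \<Rightarrow> (gen word \<Rightarrow>\<^sub>0 complex) set" where
  "kpow q m = ugen q Gk [^]\<^bsub>Uq q\<^esub> m"

definition prims :: "complex \<Rightarrow> int \<Rightarrow> int \<Rightarrow> (gen word \<Rightarrow>\<^sub>0 complex) set set" where
  "prims q m n = skew_primitives q (kpow q m) (kpow q n)"

definition cline :: "complex \<Rightarrow> (gen word \<Rightarrow>\<^sub>0 complex) set \<Rightarrow> (gen word \<Rightarrow>\<^sub>0 complex) set set" where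
  "cline q x = {c \<odot>\<^bsub>Uq q\<^esub> x | c. True}"

end

theory Submission
  imports Defs
begin

text \<open>
  Left multiplication on the PBW basis \<open>e\<^sup>b k\<^sup>a f\<^sup>c\<close> defines operators satisfying the relations of \<open>Uq\<close>,
  so the coordinates of an element in this basis are well defined; that the basis spans then
  shows that the defining ideal is exactly the kernel of the coordinate map. In the same way the
  bilinearity relations are the kernel of the coordinate map of the tensor square, on which
  left multiplication by \<open>\<Delta>(g)\<close>, for a generator \<open>g\<close>, is an explicit operator.

  With the order \<open>e, k, f\<close> the coproduct of a basis vector needs no reordering, and it turns out
  that the coefficient of \<open>\<Delta>(x)\<close> at a pair of basis vectors is a product of signs and Gaussian
  binomials at \<open>-q\<close> and \<open>-q\<^sup>-\<^sup>1\<close> times a single coefficient of \<open>x\<close>. Since \<open>q\<close> is not a root of unity,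
  the Gaussian binomials \<open>[n choose 1]\<close> do not vanish, and comparing coefficients confines a
  skew-primitive \<open>x\<close> to the basis vectors with \<open>b + c \<le> 1\<close>.
\<close>

text \<open>The Gaussian binomials come from the q-binomial theorem. In the graded product (k
  \<otimes> e)(e \<otimes> 1) = -q (e \<otimes> 1)(k \<otimes> e) and (1 \<otimes> f)(f \<otimes>
  k^-1) = -q^-1 (f \<otimes> k^-1)(1 \<otimes> f), so \<Delta>(e)^b and \<Delta>(f)^c expand with
  bases -q and -q^-1. In \<Delta>(e)^b \<Delta>(k)^a \<Delta>(f)^c only powers of k then meet
  between e and f, and carrying e^b2 past f^c1 leaves the sign (-1)^(b2 c1). The obstacle is that
  the quotients are bare sets of cosets: products are unions over representatives, and coproduct and
  counit are read off by \<open>the_elem\<close>. Every such object first needs invariance under a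
  change of representative, and a usable test for equality needs the exact kernel, not merely some
  relations inside it. This is why the PBW basis is established for \<open>Uq\<close> and
  transferred to the tensor square before any coproduct is computed.\<close>

section \<open>Scalar multiples and induction for finitely supported functions\<close>

lemma lookup_pscale [simp]:
  "Poly_Mapping.lookup (pscale c u) k = c * Poly_Mapping.lookup u k"
  by (simp add: Poly_Mapping.map.rep_eq when_def)

interpretation pm: vector_space pscale
  by unfold_locales (auto intro!: poly_mapping_eqI simp: lookup_add algebra_simps)

lemma pscale_mult_left: "pscale c a * b = pscale c (a * b)"
  for a b :: "'a::monoid_add \<Rightarrow>\<^sub>0 complex"
  by (simp add: mult_map_scale_conv_mult mult.assoc)

lemma pscale_single [simp]:
  "pscale c (Poly_Mapping.single k d) = Poly_Mapping.single k (c * d)"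
  by (rule poly_mapping_eqI) (simp add: lookup_single when_def)

lemma poly_mapping_sum_single:
  fixes u :: "'k \<Rightarrow>\<^sub>0 'c::comm_monoid_add"
  shows "u = (\<Sum>k\<in>Poly_Mapping.keys u. Poly_Mapping.single k (Poly_Mapping.lookup u k))"
  by (rule poly_mapping_eqI)
    (auto simp: lookup_sum lookup_single when_def in_keys_iff sum.delta)

text \<open>The induction runs over the keys of the given \<open>u\<close> only, so a carrier
  condition on these keys is at hand in the single case.\<close>

lemma poly_mapping_linear_induct [case_names zero single add]:
  fixes u :: "'k \<Rightarrow>\<^sub>0 'c::comm_monoid_add"
  assumes "P 0" and "\<And>k c. k \<in> Poly_Mapping.keys u \<Longrightarrow> P (Poly_Mapping.single k c)"
    and "\<And>a b. P a \<Longrightarrow> P b \<Longrightarrow> P (a + b)"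
  shows "P u"
proof -
  have "P (\<Sum>k\<in>K. Poly_Mapping.single k (Poly_Mapping.lookup u k))"
    if "finite K" "K \<subseteq> Poly_Mapping.keys u" for K
    using that by (induction K rule: finite_induct) (auto intro: assms)
  then show ?thesis
    using poly_mapping_sum_single[of u] by (metis finite_keys subset_refl)
qed

lemma pscale_mult_right: "a * pscale c b = pscale c (a * b)"
  for a b :: "'a::monoid_add \<Rightarrow>\<^sub>0 complex"
proof -
  \<comment> \<open>Scaling is multiplication by the constant \<open>single 0 c\<close>, which is
    central because 0 is the neutral key.\<close>
  have "Poly_Mapping.single 0 c * a = a * Poly_Mapping.single 0 c"
    by (induction a rule: poly_mapping_linear_induct)
      (simp_all add: mult_single mult.commute distrib_left distrib_right)
  then show ?thesis
    by (metis mult_map_scale_conv_mult mult.assoc)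
qed


section \<open>Linear extension and representations of the free algebra\<close>

definition lext :: "('k \<Rightarrow> complex) \<Rightarrow> ('k \<Rightarrow>\<^sub>0 complex) \<Rightarrow> complex" where
  "lext f u = (\<Sum>k\<in>Poly_Mapping.keys u. Poly_Mapping.lookup u k * f k)"

lemma lext_superset:
  assumes "finite K" "Poly_Mapping.keys u \<subseteq> K"
  shows "lext f u = (\<Sum>k\<in>K. Poly_Mapping.lookup u k * f k)"
  unfolding lext_def using assms by (intro sum.mono_neutral_left) (auto simp: in_keys_iff)

lemma lext_zero [simp]: "lext f 0 = 0"
  by (simp add: lext_def)

lemma lext_add: "lext f (u + v) = lext f u + lext f v"
proof -
  let ?K = "Poly_Mapping.keys u \<union> Poly_Mapping.keys v"
  have "Poly_Mapping.keys (u + v) \<subseteq> ?K" by (rule Poly_Mapping.keys_add)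
  then show ?thesis
    by (simp add: lext_superset[where K = ?K] lookup_add algebra_simps sum.distrib)
qed

lemma lext_single [simp]: "lext f (Poly_Mapping.single k c) = c * f k"
  by (simp add: lext_superset[where K = "{k}"])

lemma lext_pscale: "lext f (pscale c u) = c * lext f u"
proof -
  have "Poly_Mapping.keys (pscale c u) \<subseteq> Poly_Mapping.keys u"
    by (auto simp: in_keys_iff)
  then show ?thesis
    by (simp add: lext_superset[where K = "Poly_Mapping.keys u"] sum_distrib_left mult.assoc)
qed

lemma lext_diff: "lext f (u - v) = lext f u - lext f v"
  using lext_add[of f "u - v" v] by simp

lemma lext_sum: "lext f (\<Sum>x\<in>X. u x) = (\<Sum>x\<in>X. lext f (u x))"
  by (induction X rule: infinite_finite_induct) (auto simp: lext_add)

lemma lext_cong: "(\<And>k. k \<in> Poly_Mapping.keys u \<Longrightarrow> f k = g k) \<Longrightarrow> lext f u = lext g u"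
  by (simp add: lext_def)

lemma lext_scale: "lext (\<lambda>k. c * f k) u = c * lext f u"
  by (simp add: lext_def sum_distrib_left algebra_simps)

definition delta :: "'i \<Rightarrow> 'i \<Rightarrow> complex" where
  "delta i = (\<lambda>j. if j = i then 1 else 0)"

text \<open>Since \<open>T (e i)\<close> is the i-th unit vector, \<open>T\<close> reads off the
  coefficients of a combination of the \<open>e i\<close>, while it kills \<open>N\<close>. An
  element of the span killed by \<open>T\<close> thus has zero \<open>e\<close>-part. Applied once
  to the free algebra and once to the tensor square.\<close>

lemma kernel_of_spanning:
  fixes T :: "('k \<Rightarrow>\<^sub>0 complex) \<Rightarrow> 'i \<Rightarrow> complex"
  assumes N: "pm.subspace N"
    and T_add: "\<And>u v i. T (u + v) i = T u i + T v i"
    and T_scale: "\<And>c u i. T (pscale c u) i = c * T u i"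
    and T_N: "\<And>u i. u \<in> N \<Longrightarrow> T u i = 0"
    and T_e: "\<And>i. T (e i) = delta i"
    and u: "u \<in> pm.span (range e \<union> N)" "\<And>i. T u i = 0"
  shows "u \<in> N"
proof -
  from u(1) obtain x y where xy: "u = x + y" "x \<in> pm.span (range e)" "y \<in> N"
    unfolding pm.span_Un pm.span_eq_iff[THEN iffD2, OF N] by blast
  from xy(2) obtain S r where S: "finite S" "S \<subseteq> range e" "x = (\<Sum>a\<in>S. pscale (r a) a)"
    unfolding pm.span_explicit by blast
  have T_sum: "T (\<Sum>a\<in>S. pscale (r a) a) i = (\<Sum>a\<in>S. r a * T a i)" for i
    using T_scale[of 0] by (induction S rule: infinite_finite_induct) (auto simp: T_add T_scale)
  have "r a = 0" if "a \<in> S" for a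
  proof -
    obtain i where i: "a = e i" using \<open>a \<in> S\<close> S(2) by blast
    have "T b i = (if b = a then 1 else 0)" if "b \<in> S" for b
      using that S(2) by (auto simp: i T_e delta_def)
    then have "(\<Sum>b\<in>S. r b * T b i) = (\<Sum>b\<in>S. if b = a then r b else 0)"
      by (intro sum.cong) auto
    also have "\<dots> = r a"
      using S(1) \<open>a \<in> S\<close> by simp
    finally have "T x i = r a" by (simp add: S(3) T_sum)
    moreover have "T x i = 0"
      using u(2)[of i] T_N[OF xy(3), of i] by (simp add: xy(1) T_add)
    ultimately show ?thesis by simp
  qed
  then have "x = 0" by (simp add: S(3))
  with xy show ?thesis by simp
qed

text \<open>Operators act on all coordinate functions, of finite support or not; linearity is stated
  pointwise so that it rewrites terms \<open>L (\<lambda>i. ...) i\<close> directly.\<close>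

definition lin_op :: "(('i \<Rightarrow> complex) \<Rightarrow> 'j \<Rightarrow> complex) \<Rightarrow> bool" where
  "lin_op L \<longleftrightarrow> (\<forall>u v i. L (\<lambda>i. u i + v i) i = L u i + L v i) \<and>
     (\<forall>c u i. L (\<lambda>i. c * u i) i = c * L u i)"

lemma lin_op_add: "lin_op L \<Longrightarrow> L (\<lambda>i. u i + v i) i = L u i + L v i"
  and lin_op_scale: "lin_op L \<Longrightarrow> L (\<lambda>i. c * u i) i = c * L u i"
  by (auto simp: lin_op_def)

lemma lin_op_zero: "lin_op L \<Longrightarrow> L (\<lambda>i. 0) i = 0"
  using lin_op_scale[of L 0 "\<lambda>i. 0" i] by simp

lemma lin_op_sum: "lin_op L \<Longrightarrow> L (\<lambda>i. \<Sum>x\<in>X. c x * u x i) i = (\<Sum>x\<in>X. c x * L (u x) i)"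
  by (induction X rule: infinite_finite_induct)
    (auto simp: lin_op_zero[of L] lin_op_add[of L] lin_op_scale[of L])

lemma lin_op_lext: "lin_op L \<Longrightarrow> L (\<lambda>i. lext (\<lambda>k. f k i) u) i = lext (\<lambda>k. L (f k) i) u"
  unfolding lext_def by (rule lin_op_sum)

text \<open>Letters act by \<open>foldr\<close>, the leftmost one being applied last; this turns
  concatenation into composition and makes the free algebra act on the left.\<close>

definition rep :: "('g \<Rightarrow> ('i \<Rightarrow> complex) \<Rightarrow> 'i \<Rightarrow> complex) \<Rightarrow> ('g word \<Rightarrow>\<^sub>0 complex)
    \<Rightarrow> ('i \<Rightarrow> complex) \<Rightarrow> 'i \<Rightarrow> complex" where
  "rep act a v i = lext (\<lambda>w. foldr act (letters w) v i) a"

lemma rep_zero [simp]: "rep act 0 v i = 0"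
  and rep_add: "rep act (a + b) v i = rep act a v i + rep act b v i"
  and rep_diff: "rep act (a - b) v i = rep act a v i - rep act b v i"
  and rep_pscale: "rep act (pscale c a) v i = c * rep act a v i"
  and rep_single: "rep act (Poly_Mapping.single w c) v i = c * foldr act (letters w) v i"
  and rep_sum: "rep act (\<Sum>x\<in>X. h x) v i = (\<Sum>x\<in>X. rep act (h x) v i)"
  by (simp_all add: rep_def lext_add lext_diff lext_pscale lext_sum)

lemma rep_one [simp]: "rep act 1 v i = v i"
  by (simp add: rep_single zero_word_def flip: single_one)

lemma rep_free_gen [simp]: "rep act (free_gen g) v i = act g v i"
  by (simp add: free_gen_def rep_single)

lemma lin_op_foldr:
  assumes "\<And>g. lin_op (act g)"
  shows "lin_op (foldr act ws)"
proof (induction ws)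
  case (Cons g ws)
  have "foldr act ws (\<lambda>i. u i + v i) = (\<lambda>i. foldr act ws u i + foldr act ws v i)"
    "foldr act ws (\<lambda>i. c * u i) = (\<lambda>i. c * foldr act ws u i)" for u v c
    using Cons by (auto simp: lin_op_def)
  then show ?case
    using assms[of g] by (simp add: lin_op_def)
qed (simp add: lin_op_def)

text \<open>For words this is \<open>foldr\<close> over an append. The operators must be linear
  because \<open>rep act b v\<close> combines the results of several words, and the word in front
  acts on their sum.\<close>

lemma rep_mult:
  assumes "\<And>g. lin_op (act g)"
  shows "rep act (a * b) v = rep act a (rep act b v)"
proof (rule ext)
  fix i
  have lin: "lin_op (foldr act ws)" for ws
    by (rule lin_op_foldr[OF assms])
  have *: "rep act (Poly_Mapping.single w c * b) v i
      = c * foldr act (letters w) (rep act b v) i" for w c i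
  proof (induction b rule: poly_mapping_linear_induct)
    case zero
    then show ?case by (simp add: rep_def[abs_def] lin_op_zero[OF lin])
  next
    case (single k d)
    then show ?case
      by (simp add: mult_single rep_single plus_word_def ext[OF rep_single] lin_op_scale[OF lin])
  next
    case (add b b')
    then show ?case
      by (simp add: distrib_left rep_add ext[OF rep_add] lin_op_add[OF lin])
  qed
  show "rep act (a * b) v i = rep act a (rep act b v) i"
  proof (induction a rule: poly_mapping_linear_induct)
    case (single k c)
    then show ?case by (simp add: * rep_single)
  qed (simp_all add: distrib_right rep_add)
qed

lemma lin_op_rep: "(\<And>g. lin_op (act g)) \<Longrightarrow> lin_op (rep act a)"
  using lin_op_foldr[of act]
  by (induction a rule: poly_mapping_linear_induct)
    (auto simp: lin_op_def rep_single rep_add algebra_simps)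

section \<open>Quotients by the kernel of a linear map\<close>

text \<open>This is the shape of \<open>comult\<close> and \<open>counit\<close>: folding the
  definition reduces their well-definedness to \<open>qmap_coset_const\<close>.\<close>

definition qmap :: "('v \<Rightarrow> 'w) \<Rightarrow> 'v set \<Rightarrow> 'w" where
  "qmap T X = the_elem (T ` X)"

text \<open>If the ideal is the kernel of \<open>T\<close>, its cosets are the fibres of
  \<open>T\<close>, and equality in the quotient is equality of coordinates. Compatibility of the
  product and the grading with \<open>T\<close> is proved by different means for \<open>Uq\<close>
  and for the tensor square, so \<open>coset_mult\<close> and \<open>coset_hpart\<close> take it as
  a premise.\<close>

locale kernel_quotient =
  fixes A :: "('v::ab_group_add, 'm) superalg_scheme"
    and I :: "'v set"
    and T :: "'v \<Rightarrow> 'i \<Rightarrow> complex"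
  assumes add_eq: "add A = (+)"
    and zero_closed: "0 \<in> carrier A"
    and add_closed: "x \<in> carrier A \<Longrightarrow> y \<in> carrier A \<Longrightarrow> x + y \<in> carrier A"
    and uminus_closed: "x \<in> carrier A \<Longrightarrow> - x \<in> carrier A"
    and smult_closed: "x \<in> carrier A \<Longrightarrow> c \<odot>\<^bsub>A\<^esub> x \<in> carrier A"
    and T_add: "x \<in> carrier A \<Longrightarrow> y \<in> carrier A \<Longrightarrow> T (x + y) i = T x i + T y i"
    and T_smult: "x \<in> carrier A \<Longrightarrow> T (c \<odot>\<^bsub>A\<^esub> x) i = c * T x i"
    and kernel: "I = {x \<in> carrier A. \<forall>i. T x i = 0}"
begin

abbreviation "Q \<equiv> quot_superalg A I"
abbreviation "coset x \<equiv> I +>\<^bsub>A\<^esub> x"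

lemma T_zero: "T 0 i = 0"
  using T_add[OF zero_closed zero_closed, of i] by simp

lemma T_uminus: "x \<in> carrier A \<Longrightarrow> T (- x) i = - T x i"
  using T_add[of x "- x" i] by (simp add: uminus_closed T_zero eq_neg_iff_add_eq_0 add.commute)

lemma diff_closed: "x \<in> carrier A \<Longrightarrow> y \<in> carrier A \<Longrightarrow> x - y \<in> carrier A"
  using add_closed[of x "- y"] by (simp add: uminus_closed)

lemma T_diff: "x \<in> carrier A \<Longrightarrow> y \<in> carrier A \<Longrightarrow> T (x - y) i = T x i - T y i"
  using T_add[of x "- y" i] by (simp add: uminus_closed T_uminus)

lemma coset_eq: "x \<in> carrier A \<Longrightarrow> coset x = {y \<in> carrier A. T y = T x}"
proof (intro equalityI subsetI)
  fix y assume x: "x \<in> carrier A" and "y \<in> coset x"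
  then obtain h where "h \<in> I" "y = h + x"
    by (auto simp: a_r_coset_def' add_eq)
  with x show "y \<in> {y \<in> carrier A. T y = T x}"
    by (auto simp: kernel add_closed T_add)
next
  fix y assume x: "x \<in> carrier A" and y: "y \<in> {y \<in> carrier A. T y = T x}"
  then have "y - x \<in> I"
    by (auto simp: kernel diff_closed T_diff)
  then have "(y - x) + x \<in> coset x"
    unfolding a_r_coset_def' add_eq by blast
  then show "y \<in> coset x" by simp
qed

lemma coset_eq_iff:
  "x \<in> carrier A \<Longrightarrow> y \<in> carrier A \<Longrightarrow> coset x = coset y \<longleftrightarrow> T x = T y"
  by (auto simp: coset_eq)

lemma carrier_Q: "carrier Q = coset ` carrier A"
  by (auto simp: quot_superalg_def A_RCOSETS_def')

lemma coset_carrier [simp]: "x \<in> carrier A \<Longrightarrow> coset x \<in> carrier Q"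
  by (auto simp: carrier_Q)

lemma carrier_QE:
  assumes "X \<in> carrier Q"
  obtains x where "x \<in> carrier A" "X = coset x"
  using assms by (auto simp: carrier_Q)

lemma qmap_coset_const:
  assumes "x \<in> carrier A" "\<And>y. y \<in> carrier A \<Longrightarrow> T y = T x \<Longrightarrow> f y = f x"
  shows "qmap f (coset x) = f x"
proof -
  have "f y = f x" if "y \<in> coset x" for y
    using that assms(2)[of y] by (simp add: coset_eq[OF assms(1)])
  moreover have "x \<in> coset x"
    using assms(1) by (simp add: coset_eq)
  ultimately have "f ` coset x = {f x}" by blast
  then show ?thesis by (simp add: qmap_def)
qed

lemma qmap_coset [simp]: "x \<in> carrier A \<Longrightarrow> qmap T (coset x) = T x"
  by (rule qmap_coset_const)

lemma qmap_inj:
  "X \<in> carrier Q \<Longrightarrow> Y \<in> carrier Q \<Longrightarrow> X = Y \<longleftrightarrow> (\<forall>i. qmap T X i = qmap T Y i)"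
  by (metis carrier_QE coset_eq_iff ext qmap_coset)

lemma coset_add:
  assumes "x \<in> carrier A" "y \<in> carrier A"
  shows "coset x \<oplus>\<^bsub>Q\<^esub> coset y = coset (x + y)"
proof -
  have "coset x \<oplus>\<^bsub>Q\<^esub> coset y = {a + b | a b. a \<in> coset x \<and> b \<in> coset y}"
    by (auto simp: quot_superalg_def set_add_def' add_eq)
  also have "\<dots> = coset (x + y)"
  proof (intro equalityI subsetI)
    fix z assume "z \<in> coset (x + y)"
    with assms have "z - y \<in> coset x" "y \<in> coset y"
      by (auto simp: coset_eq add_closed diff_closed T_add T_diff)
    then show "z \<in> {a + b | a b. a \<in> coset x \<and> b \<in> coset y}"
      by (metis (mono_tags, lifting) mem_Collect_eq diff_add_cancel)
  qed (use assms in \<open>auto simp: coset_eq add_closed T_add\<close>)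
  finally show ?thesis .
qed

lemma zero_Q: "\<zero>\<^bsub>Q\<^esub> = coset 0"
proof -
  have "I = coset 0"
    by (auto simp: coset_eq[OF zero_closed] T_zero fun_eq_iff) (simp_all add: kernel)
  then show ?thesis by (simp add: quot_superalg_def)
qed

lemma coset_const_UN:
  assumes x: "x \<in> carrier A" and "f x \<in> carrier A"
    and "\<And>y. y \<in> carrier A \<Longrightarrow> T y = T x \<Longrightarrow> f y \<in> carrier A \<and> T (f y) = T (f x)"
  shows "(\<Union>y\<in>coset x. coset (f y)) = coset (f x)"
proof -
  have "coset (f y) = coset (f x)" if "y \<in> coset x" for y
    using that assms(2) assms(3)[of y] by (simp add: coset_eq[OF x] coset_eq_iff)
  moreover have "x \<in> coset x"
    using x by (simp add: coset_eq)
  ultimately show ?thesis by blast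
qed

lemma coset_smult: "x \<in> carrier A \<Longrightarrow> c \<odot>\<^bsub>Q\<^esub> coset x = coset (c \<odot>\<^bsub>A\<^esub> x)"
  by (simp add: quot_superalg_def)
    (rule coset_const_UN, auto simp: smult_closed T_smult)

lemma coset_hpart:
  assumes "x \<in> carrier A" "hpart A j x \<in> carrier A"
    and "\<And>y. y \<in> carrier A \<Longrightarrow> T y = T x \<Longrightarrow>
      hpart A j y \<in> carrier A \<and> T (hpart A j y) = T (hpart A j x)"
  shows "hpart Q j (coset x) = coset (hpart A j x)"
  by (simp add: quot_superalg_def) (rule coset_const_UN[where f = "hpart A j", OF assms])

lemma coset_mult:
  assumes x: "x \<in> carrier A" and y: "y \<in> carrier A"
    and *: "\<And>x' y'. x' \<in> carrier A \<Longrightarrow> y' \<in> carrier A \<Longrightarrow> T x' = T x \<Longrightarrow> T y' = T y \<Longrightarrow>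
      x' \<otimes>\<^bsub>A\<^esub> y' \<in> carrier A \<and> T (x' \<otimes>\<^bsub>A\<^esub> y') = T (x \<otimes>\<^bsub>A\<^esub> y)"
  shows "coset x \<otimes>\<^bsub>Q\<^esub> coset y = coset (x \<otimes>\<^bsub>A\<^esub> y)"
proof -
  have xy: "x \<otimes>\<^bsub>A\<^esub> y \<in> carrier A" using * x y by blast
  have "coset (x' \<otimes>\<^bsub>A\<^esub> y') = coset (x \<otimes>\<^bsub>A\<^esub> y)" if "x' \<in> coset x" "y' \<in> coset y" for x' y'
    using that *[of x' y'] xy by (simp add: coset_eq[OF x] coset_eq[OF y] coset_eq_iff)
  moreover have "x \<in> coset x" "y \<in> coset y"
    using x y by (simp_all add: coset_eq)
  ultimately have "(\<Union>x'\<in>coset x. \<Union>y'\<in>coset y. coset (x' \<otimes>\<^bsub>A\<^esub> y')) = coset (x \<otimes>\<^bsub>A\<^esub> y)"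
    by blast
  then show ?thesis by (simp add: quot_superalg_def rcoset_mult_def)
qed

lemma abelian_group_Q: "abelian_group Q"
proof (rule abelian_groupI)
  show "\<exists>y\<in>carrier Q. y \<oplus>\<^bsub>Q\<^esub> x = \<zero>\<^bsub>Q\<^esub>" if "x \<in> carrier Q" for x
  proof -
    from that obtain a where "a \<in> carrier A" "x = coset a" by (rule carrier_QE)
    then show ?thesis
      by (intro bexI[of _ "coset (- a)"]) (simp_all add: coset_add uminus_closed zero_Q)
  qed
qed (auto elim!: carrier_QE simp: coset_add zero_Q add_closed zero_closed ac_simps)

sublocale Q: abelian_group Q
  by (rule abelian_group_Q)

lemma smult_Q_closed [simp]: "X \<in> carrier Q \<Longrightarrow> c \<odot>\<^bsub>Q\<^esub> X \<in> carrier Q"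
  by (auto elim!: carrier_QE simp: coset_smult smult_closed)

lemma qmap_add:
  "X \<in> carrier Q \<Longrightarrow> Y \<in> carrier Q \<Longrightarrow> qmap T (X \<oplus>\<^bsub>Q\<^esub> Y) i = qmap T X i + qmap T Y i"
  by (auto elim!: carrier_QE simp: coset_add add_closed T_add)

lemma qmap_smult: "X \<in> carrier Q \<Longrightarrow> qmap T (c \<odot>\<^bsub>Q\<^esub> X) i = c * qmap T X i"
  by (auto elim!: carrier_QE simp: coset_smult smult_closed T_smult)

lemma qmap_zero [simp]: "qmap T \<zero>\<^bsub>Q\<^esub> i = 0"
  by (simp add: zero_Q zero_closed T_zero)

lemma qmap_diff:
  assumes "X \<in> carrier Q" "Y \<in> carrier Q"
  shows "qmap T (X \<ominus>\<^bsub>Q\<^esub> Y) i = qmap T X i - qmap T Y i"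
proof -
  have "X = (X \<ominus>\<^bsub>Q\<^esub> Y) \<oplus>\<^bsub>Q\<^esub> Y"
    using assms by (simp add: a_minus_def Q.a_assoc Q.l_neg)
  then show ?thesis
    using qmap_add[of "X \<ominus>\<^bsub>Q\<^esub> Y" Y i] assms by (metis Q.minus_closed add_diff_cancel_right')
qed

lemma qmap_finsum:
  assumes "finite F" "h \<in> F \<rightarrow> carrier Q"
  shows "qmap T (finsum Q h F) i = (\<Sum>x\<in>F. qmap T (h x) i)"
  using assms by (induction F rule: finite_induct) (auto simp: qmap_add)

end

section \<open>The PBW representation\<close>

lemma free_superalg_simps [simp]:
  "carrier (free_superalg p) = UNIV" "mult (free_superalg p) = (*)" "one (free_superalg p) = 1"
  "zero (free_superalg p) = 0" "add (free_superalg p) = (+)" "smult (free_superalg p) = pscale"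
  by (simp_all add: free_superalg_def)

lemma ring_free_superalg: "ring (free_superalg p)"
proof (rule ringI)
  show "abelian_group (free_superalg p)"
    by (rule abelian_groupI) (auto simp: ac_simps intro: exI[of _ "- x" for x])
  show "monoid (free_superalg p)"
    by unfold_locales (auto simp: mult.assoc)
qed (auto simp: algebra_simps)

lemma a_inv_free_superalg: "\<ominus>\<^bsub>free_superalg p\<^esub> a = - a"
proof -
  interpret ring "free_superalg p" by (rule ring_free_superalg)
  show ?thesis by (rule minus_equality) simp_all
qed

lemma ideal_osp_ideal: "ideal (osp_ideal q) free_osp"
  unfolding osp_ideal_def by (rule ring.genideal_ideal[OF ring_free_superalg]) simp

lemma osp_rels_subset: "osp_rels q \<subseteq> osp_ideal q"
  unfolding osp_ideal_def by (rule ring.genideal_self[OF ring_free_superalg]) simp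

lemma osp_ideal_0: "0 \<in> osp_ideal q"
  and osp_ideal_add: "a \<in> osp_ideal q \<Longrightarrow> b \<in> osp_ideal q \<Longrightarrow> a + b \<in> osp_ideal q"
  and osp_ideal_uminus: "a \<in> osp_ideal q \<Longrightarrow> - a \<in> osp_ideal q"
  and osp_ideal_mult_left: "a \<in> osp_ideal q \<Longrightarrow> b * a \<in> osp_ideal q"
  and osp_ideal_mult_right: "a \<in> osp_ideal q \<Longrightarrow> a * b \<in> osp_ideal q"
proof -
  interpret ideal "osp_ideal q" free_osp by (rule ideal_osp_ideal)
  note additive = additive_subgroup_axioms
  show "0 \<in> osp_ideal q" "a \<in> osp_ideal q \<Longrightarrow> b \<in> osp_ideal q \<Longrightarrow> a + b \<in> osp_ideal q"
    "a \<in> osp_ideal q \<Longrightarrow> - a \<in> osp_ideal q"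
    "a \<in> osp_ideal q \<Longrightarrow> b * a \<in> osp_ideal q" "a \<in> osp_ideal q \<Longrightarrow> a * b \<in> osp_ideal q"
    using additive_subgroup.zero_closed[OF additive] additive_subgroup.a_closed[OF additive, of a b]
      additive_subgroup.a_inv_closed[OF additive, of a] I_l_closed[of a b] I_r_closed[of a b]
    by (simp_all add: a_inv_free_superalg)
qed

lemma osp_ideal_pscale: "a \<in> osp_ideal q \<Longrightarrow> pscale c a \<in> osp_ideal q"
  by (simp add: mult_map_scale_conv_mult osp_ideal_mult_left)

text \<open>The elements that act as zero form a two-sided ideal, so they contain the least ideal
  containing the relations. Operators that satisfy the five relations thus descend to
  \<open>Uq\<close>.\<close>

lemma rep_osp_ideal:
  assumes lin: "\<And>g. lin_op (act g)"
    and rels: "\<And>r v i. r \<in> osp_rels q \<Longrightarrow> rep act r v i = 0"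
    and "a \<in> osp_ideal q"
  shows "rep act a v i = 0"
proof -
  define J where "J = {a. \<forall>v i. rep act a v i = 0}"
  have zero: "rep act a (\<lambda>i. 0) i = 0" for a i
    by (rule lin_op_zero[OF lin_op_rep[OF lin]])
  have "ideal J free_osp"
  proof (rule idealI)
    show "subgroup J (add_monoid free_osp)"
    proof
      fix a assume "a \<in> J"
      then have "- a \<in> J"
        using rep_diff[of act 0 a] by (simp add: J_def)
      then show "inv\<^bsub>add_monoid free_osp\<^esub> a \<in> J"
        using a_inv_free_superalg[of gen_parity a] by (simp only: a_inv_def)
    qed (auto simp: J_def rep_add)
  next
    fix a x assume "a \<in> J"
    then have "rep act a v = (\<lambda>i. 0)" for v
      by (auto simp: J_def)
    then show "x \<otimes>\<^bsub>free_osp\<^esub> a \<in> J" "a \<otimes>\<^bsub>free_osp\<^esub> x \<in> J"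
      by (auto simp: J_def rep_mult[OF lin] zero)
  qed (rule ring_free_superalg)
  moreover have "osp_rels q \<subseteq> J"
    using rels by (auto simp: J_def)
  ultimately have "osp_ideal q \<subseteq> J"
    unfolding osp_ideal_def by (rule ring.genideal_minimal[OF ring_free_superalg])
  with \<open>a \<in> osp_ideal q\<close> show ?thesis by (auto simp: J_def)
qed

lemma rep_free_gen_fun [simp]: "rep act (free_gen g) = act g"
  by (intro ext) simp

lemma rep_one_fun [simp]: "rep act 1 = (\<lambda>v. v)"
  by (intro ext) simp

type_synonym idx = "nat \<times> int \<times> nat"

text \<open>Equal to (r^n - (-1)^n) / (r + 1) for r other than -1. One step of the recursion is one
  exchange of f with a letter e, whence the alternating signs.\<close>

fun alt_sum :: "complex \<Rightarrow> nat \<Rightarrow> complex" where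
  "alt_sum r 0 = 0"
| "alt_sum r (Suc n) = r ^ n - alt_sum r n"

text \<open>
  Left multiplication in coordinates: \<open>v (b, a, c)\<close> is the coefficient of \<open>e\<^sup>b k\<^sup>a f\<^sup>c\<close>. The operators
  make sense for coordinate functions of infinite support, since only finitely many basis vectors
  contribute to each coefficient. The \<open>Gf\<close> case comes from
  \<open>f e\<^sup>b = (-1)\<^sup>b e\<^sup>b f + e\<^sup>b\<^sup>-\<^sup>1 (alt_sum q b k - alt_sum q\<^sup>-\<^sup>1 b k\<^sup>-\<^sup>1) / (q - q\<^sup>-\<^sup>1)\<close>.
\<close>

fun act :: "complex \<Rightarrow> gen \<Rightarrow> (idx \<Rightarrow> complex) \<Rightarrow> idx \<Rightarrow> complex" where
  "act q Gk v (b, a, c) = q ^ b * v (b, a - 1, c)"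
| "act q Gk' v (b, a, c) = inverse q ^ b * v (b, a + 1, c)"
| "act q Ge v (b, a, c) = (case b of 0 \<Rightarrow> 0 | Suc b' \<Rightarrow> v (b', a, c))"
| "act q Gf v (b, a, c) = (case c of 0 \<Rightarrow> 0 | Suc c' \<Rightarrow> (-1) ^ b * q powi a * v (b, a, c'))
     + (alt_sum q (Suc b) * v (Suc b, a - 1, c) - alt_sum (inverse q) (Suc b) * v (Suc b, a + 1, c))
       / (q - inverse q)"

lemma lin_op_act [simp]: "lin_op (act q g)"
  unfolding lin_op_def by (cases g) (auto simp: algebra_simps diff_divide_distrib add_divide_distrib split: nat.splits)


text \<open>In the last relation the terms with f cancel by the sign (-1)^b, and
  \<open>alt_sum q b + alt_sum q (Suc b) = q ^ b\<close> turns the rest into the action of k -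
  k^-1.\<close>

lemma act_relations:
  assumes "q \<noteq> 0"
  shows "act q Gk (act q Gk' v) i = v i" "act q Gk' (act q Gk v) i = v i"
    "act q Gk (act q Ge (act q Gk' v)) i = q * act q Ge v i"
    "act q Gk (act q Gf (act q Gk' v)) i = inverse q * act q Gf v i"
    "act q Ge (act q Gf v) i + act q Gf (act q Ge v) i
      = (act q Gk v i - act q Gk' v i) / (q - inverse q)"
proof -
  obtain b a c where i: "i = (b, a, c)" by (cases i)
  show "act q Gk (act q Gk' v) i = v i" "act q Gk' (act q Gk v) i = v i"
    "act q Gk (act q Ge (act q Gk' v)) i = q * act q Ge v i"
    using assms by (simp_all add: i field_simps split: nat.split)
  show "act q Gk (act q Gf (act q Gk' v)) i = inverse q * act q Gf v i"
    using assms by (simp add: i power_int_diff divide_simps split: nat.split)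
  show "act q Ge (act q Gf v) i + act q Gf (act q Ge v) i
      = (act q Gk v i - act q Gk' v i) / (q - inverse q)"
    by (simp add: i divide_inverse algebra_simps split: nat.split)
qed

lemma rep_act_rels:
  assumes "q \<noteq> 0" "r \<in> osp_rels q"
  shows "rep (act q) r v i = 0"
  using assms(2)
  by (auto simp: osp_rels_def Let_def rep_diff rep_add rep_mult rep_pscale rep_one_fun
    act_relations[OF assms(1)] mult.assoc)

section \<open>The PBW basis\<close>

definition wmon :: "'g list \<Rightarrow> 'g word \<Rightarrow>\<^sub>0 complex" where
  "wmon ws = Poly_Mapping.single (Word ws) 1"

definition kword :: "int \<Rightarrow> gen list" where
  "kword a = (if a \<ge> 0 then replicate (nat a) Gk else replicate (nat (- a)) Gk')"

fun pbw_word :: "idx \<Rightarrow> gen list" where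
  "pbw_word (b, a, c) = replicate b Ge @ kword a @ replicate c Gf"

text \<open>The element acts on the basis vector (0, 0, 0), which stands for 1.\<close>

definition coords :: "complex \<Rightarrow> (gen word \<Rightarrow>\<^sub>0 complex) \<Rightarrow> idx \<Rightarrow> complex" where
  "coords q a = rep (act q) a (delta (0, 0, 0))"

lemma wmon_mult: "wmon us * wmon vs = wmon (us @ vs)"
  by (simp add: wmon_def mult_single plus_word_def)

lemma free_gen_eq_wmon: "free_gen g = wmon [g]"
  by (simp add: free_gen_def wmon_def)

lemma wmon_Nil: "wmon [] = 1"
  by (simp add: wmon_def flip: zero_word_def)

text \<open>These are the cases met when a PBW word acts from right to left on 1: all f come first,
  then the powers of k, then e. Hence b is 0 except in the case of \<open>Ge\<close>.\<close>

lemma act_delta: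
  "act q Gk (delta (0, a, c)) = delta (0, a + 1, c)"
  "act q Gk' (delta (0, a, c)) = delta (0, a - 1, c)"
  "act q Ge (delta (b, a, c)) = delta (Suc b, a, c)"
  "act q Gf (delta (0, a, c)) = (\<lambda>i. q powi a * delta (0, a, Suc c) i)"
  by (rule ext, auto simp: delta_def split: nat.splits if_splits)+

lemma foldr_kword:
  assumes k: "\<And>a. F Gk (d a) = d (a + 1)" and k': "\<And>a. F Gk' (d a) = d (a - 1)"
  shows "foldr F (kword a) (d 0) = d (a :: int)"
proof -
  have "foldr F (replicate n Gk) (d 0) = d (int n)" for n
    by (induction n) (simp_all add: k add.commute)
  moreover have "foldr F (replicate n Gk') (d 0) = d (- int n)" for n
  proof (induction n)
    case (Suc n)
    have "- int (Suc n) = - int n - 1" by simp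
    with Suc show ?case by (simp only: replicate_Suc foldr_Cons o_apply k')
  qed simp
  ultimately show ?thesis by (auto simp: kword_def)
qed

text \<open>The operators \<open>F\<close> and vectors \<open>d\<close> are kept abstract: with
  \<open>act\<close> the lemma yields the coordinates of basis vectors, with \<open>act2\<close>
  their coproducts.\<close>

lemma foldr_pbw_word:
  assumes "\<And>c. F Gf (d (0, 0, c)) = d (0, 0, Suc c)"
    and "\<And>a c. F Gk (d (0, a, c)) = d (0, a + 1, c)" "\<And>a c. F Gk' (d (0, a, c)) = d (0, a - 1, c)"
    and "\<And>b a c. F Ge (d (b, a, c)) = d (Suc b, a, c)"
  shows "foldr F (pbw_word i) (d (0, 0, 0)) = d i"
proof -
  obtain b a c where i: "i = (b, a, c)" by (cases i)
  have "foldr F (replicate c Gf) (d (0, 0, 0)) = d (0, 0, c)"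
    by (induction c) (simp_all add: assms)
  moreover have "foldr F (kword a) (d (0, 0, c)) = d (0, a, c)"
    using foldr_kword[of F "\<lambda>a. d (0, a, c)"] assms by simp
  moreover have "foldr F (replicate b Ge) (d (0, a, c)) = d (b, a, c)"
    by (induction b) (simp_all add: assms)
  ultimately show ?thesis by (simp add: i)
qed

lemma coords_pbw [simp]: "coords q (wmon (pbw_word i)) = delta i"
  unfolding coords_def
  by (rule ext) (simp add: wmon_def rep_single foldr_pbw_word act_delta)

lemma coords_add: "coords q (a + b) i = coords q a i + coords q b i"
  and coords_diff: "coords q (a - b) i = coords q a i - coords q b i"
  and coords_pscale: "coords q (pscale c a) i = c * coords q a i"
  by (simp_all add: coords_def rep_add rep_diff rep_pscale)

lemma coords_mult: "coords q (a * b) = rep (act q) a (coords q b)"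
  by (simp add: coords_def rep_mult)

lemma coords_ideal: "q \<noteq> 0 \<Longrightarrow> a \<in> osp_ideal q \<Longrightarrow> coords q a i = 0"
  unfolding coords_def by (rule rep_osp_ideal) (simp_all add: rep_act_rels)

section \<open>Straightening words modulo the defining ideal\<close>

definition cong_osp :: "complex \<Rightarrow> (gen word \<Rightarrow>\<^sub>0 complex) \<Rightarrow> (gen word \<Rightarrow>\<^sub>0 complex) \<Rightarrow> bool" where
  "cong_osp q a b \<longleftrightarrow> a - b \<in> osp_ideal q"

lemma cong_refl: "cong_osp q a a"
  by (simp add: cong_osp_def osp_ideal_0)

lemma cong_sym: "cong_osp q a b \<Longrightarrow> cong_osp q b a"
  unfolding cong_osp_def using osp_ideal_uminus by fastforce

lemma cong_trans [trans]: "cong_osp q a b \<Longrightarrow> cong_osp q b c \<Longrightarrow> cong_osp q a c"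
  unfolding cong_osp_def using osp_ideal_add by fastforce

lemma cong_pscale: "cong_osp q a b \<Longrightarrow> cong_osp q (pscale c a) (pscale c b)"
  unfolding cong_osp_def using osp_ideal_pscale[of "a - b" q c] by (simp add: pm.scale_right_diff_distrib)

lemma cong_mult_left: "cong_osp q a b \<Longrightarrow> cong_osp q (c * a) (c * b)"
  unfolding cong_osp_def using osp_ideal_mult_left[of "a - b" q c] by (simp add: right_diff_distrib)

lemma cong_mult_right: "cong_osp q a b \<Longrightarrow> cong_osp q (a * c) (b * c)"
  unfolding cong_osp_def using osp_ideal_mult_right[of "a - b" q c] by (simp add: left_diff_distrib)

lemma cong_Cons: "cong_osp q (wmon us) (wmon vs) \<Longrightarrow> cong_osp q (wmon (g # us)) (wmon (g # vs))"
  using cong_mult_left[of q "wmon us" "wmon vs" "wmon [g]"] by (simp add: wmon_mult)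

text \<open>The relations as exchange rules for the first two letters of a word, each moving the
  leading letter to the right towards the order e, k, f or cancelling it. The relations between k
  and e or f conjugate by k, so the rules arise by inserting k^-1 k.\<close>

lemma cong_relations:
  assumes "q \<noteq> 0"
  shows cong_k_k': "cong_osp q (wmon (Gk # Gk' # ws)) (wmon ws)"
    and cong_k'_k: "cong_osp q (wmon (Gk' # Gk # ws)) (wmon ws)"
    and cong_k_e: "cong_osp q (wmon (Gk # Ge # ws)) (pscale q (wmon (Ge # Gk # ws)))"
    and cong_k'_e: "cong_osp q (wmon (Gk' # Ge # ws)) (pscale (inverse q) (wmon (Ge # Gk' # ws)))"
    and cong_f_k: "cong_osp q (wmon (Gf # Gk # ws)) (pscale q (wmon (Gk # Gf # ws)))"
    and cong_f_k': "cong_osp q (wmon (Gf # Gk' # ws)) (pscale (inverse q) (wmon (Gk' # Gf # ws)))"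
    and cong_f_e: "cong_osp q (wmon (Gf # Ge # ws))
      (pscale (1 / (q - inverse q)) (wmon (Gk # ws) - wmon (Gk' # ws)) - wmon (Ge # Gf # ws))"
proof -
  note rels = subsetD[OF osp_rels_subset, of _ q, unfolded osp_rels_def Let_def]
  have k_k': "cong_osp q (wmon (Gk # Gk' # ws)) (wmon ws)" for ws
    using cong_mult_right[of q "wmon [Gk, Gk']" 1 "wmon ws"] rels
    by (simp add: cong_osp_def free_gen_eq_wmon wmon_mult)
  have k'_k: "cong_osp q (wmon (Gk' # Gk # ws)) (wmon ws)" for ws
    using cong_mult_right[of q "wmon [Gk', Gk]" 1 "wmon ws"] rels
    by (simp add: cong_osp_def free_gen_eq_wmon wmon_mult)
  have k_e_k': "cong_osp q (wmon (Gk # Ge # Gk' # ws)) (pscale q (wmon (Ge # ws)))" for ws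
    using cong_mult_right[of q "wmon [Gk, Ge, Gk']" "pscale q (wmon [Ge])" "wmon ws"] rels
    by (simp add: cong_osp_def free_gen_eq_wmon wmon_mult pscale_mult_left)
  have k_f_k': "cong_osp q (wmon (Gk # Gf # Gk' # ws)) (pscale (inverse q) (wmon (Gf # ws)))" for ws
    using cong_mult_right[of q "wmon [Gk, Gf, Gk']" "pscale (inverse q) (wmon [Gf])" "wmon ws"] rels
    by (simp add: cong_osp_def free_gen_eq_wmon wmon_mult pscale_mult_left)
  show "cong_osp q (wmon (Gk # Gk' # ws)) (wmon ws)" "cong_osp q (wmon (Gk' # Gk # ws)) (wmon ws)"
    by (fact k_k' k'_k)+
  have "cong_osp q (wmon (Gk # Ge # ws)) (wmon (Gk # Ge # Gk' # Gk # ws))"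
    by (intro cong_Cons cong_sym[OF k'_k])
  also note k_e_k'
  finally show "cong_osp q (wmon (Gk # Ge # ws)) (pscale q (wmon (Ge # Gk # ws)))" .
  have "cong_osp q (wmon (Ge # Gk' # ws)) (wmon (Gk' # Gk # Ge # Gk' # ws))"
    by (rule cong_sym[OF k'_k])
  also have "cong_osp q (wmon (Gk' # Gk # Ge # Gk' # ws)) (pscale q (wmon (Gk' # Ge # ws)))"
    using cong_mult_left[OF k_e_k', of "wmon [Gk']" ws] by (simp add: pscale_mult_right wmon_mult)
  finally have "cong_osp q (pscale (inverse q) (wmon (Ge # Gk' # ws)))
      (pscale (inverse q) (pscale q (wmon (Gk' # Ge # ws))))"
    by (rule cong_pscale)
  then show "cong_osp q (wmon (Gk' # Ge # ws)) (pscale (inverse q) (wmon (Ge # Gk' # ws)))"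
    using \<open>q \<noteq> 0\<close> by (simp add: cong_sym)
  have "cong_osp q (wmon (Gk # Gf # ws)) (wmon (Gk # Gf # Gk' # Gk # ws))"
    by (intro cong_Cons cong_sym[OF k'_k])
  also note k_f_k'
  finally have "cong_osp q (pscale q (wmon (Gk # Gf # ws)))
      (pscale q (pscale (inverse q) (wmon (Gf # Gk # ws))))"
    by (rule cong_pscale)
  then show "cong_osp q (wmon (Gf # Gk # ws)) (pscale q (wmon (Gk # Gf # ws)))"
    using \<open>q \<noteq> 0\<close> by (simp add: cong_sym)
  have "cong_osp q (wmon (Gf # Gk' # ws)) (wmon (Gk' # Gk # Gf # Gk' # ws))"
    by (rule cong_sym[OF k'_k])
  also have "cong_osp q (wmon (Gk' # Gk # Gf # Gk' # ws)) (pscale (inverse q) (wmon (Gk' # Gf # ws)))"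
    using cong_mult_left[OF k_f_k', of "wmon [Gk']" ws] by (simp add: pscale_mult_right wmon_mult)
  finally show "cong_osp q (wmon (Gf # Gk' # ws)) (pscale (inverse q) (wmon (Gk' # Gf # ws)))" .
  have "cong_osp q (wmon [Gf, Ge]) (pscale (1 / (q - inverse q)) (wmon [Gk] - wmon [Gk']) - wmon [Ge, Gf])"
    using rels by (simp add: cong_osp_def free_gen_eq_wmon wmon_mult algebra_simps)
  from cong_mult_right[OF this, of "wmon ws"]
  show "cong_osp q (wmon (Gf # Ge # ws))
      (pscale (1 / (q - inverse q)) (wmon (Gk # ws) - wmon (Gk' # ws)) - wmon (Ge # Gf # ws))"
    by (simp add: wmon_mult left_diff_distrib pscale_mult_left)
qed

abbreviation pbw_spanned :: "complex \<Rightarrow> (gen word \<Rightarrow>\<^sub>0 complex) \<Rightarrow> bool" where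
  "pbw_spanned q a \<equiv> a \<in> pm.span (range (\<lambda>i. wmon (pbw_word i)) \<union> osp_ideal q)"

lemma pbw_spanned_pbw: "pbw_spanned q (wmon (pbw_word i))"
  by (auto intro: pm.span_base)

lemma pbw_spanned_cong: "cong_osp q a b \<Longrightarrow> pbw_spanned q b \<Longrightarrow> pbw_spanned q a"
  using pm.span_add[of "a - b" _ b] pm.span_base[of "a - b"] by (simp add: cong_osp_def)

lemma pbw_spanned_mult_left:
  assumes *: "\<And>i. pbw_spanned q (d * wmon (pbw_word i))" and "pbw_spanned q a"
  shows "pbw_spanned q (d * a)"
  using assms(2)
proof (rule pm.span_induct)
  show "pm.subspace {a. pbw_spanned q (d * a)}"
    by (auto simp: pm.subspace_def distrib_left pscale_mult_right pm.span_zero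
      intro: pm.span_add pm.span_scale)
next
  fix a assume "a \<in> range (\<lambda>i. wmon (pbw_word i)) \<union> osp_ideal q"
  then show "pbw_spanned q (d * a)"
  proof
    assume "a \<in> osp_ideal q"
    then show ?thesis
      using osp_ideal_mult_left by (blast intro: pm.span_base)
  qed (use * in blast)
qed

lemma pbw_spanned_Cons:
  assumes "\<And>i. pbw_spanned q (wmon (g # pbw_word i))" "pbw_spanned q (wmon ws)"
  shows "pbw_spanned q (wmon (g # ws))"
  using pbw_spanned_mult_left[of "wmon [g]" q "wmon ws"] assms by (simp add: wmon_mult)

lemma cong_k_kword:
  assumes "q \<noteq> 0"
  shows "cong_osp q (wmon (Gk # kword a @ ws)) (wmon (kword (a + 1) @ ws))"
proof (cases "a \<ge> 0")
  case True
  then have "Gk # kword a = kword (a + 1)"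
    by (simp add: kword_def nat_add_distrib)
  then show ?thesis by (metis Cons_eq_appendI cong_refl)
next
  case False
  then have "nat (- a) = Suc (nat (- (a + 1)))" by linarith
  with False have "kword a = Gk' # kword (a + 1)"
    by (auto simp: kword_def)
  then show ?thesis using cong_k_k'[OF assms] by simp
qed

lemma cong_k'_kword:
  assumes "q \<noteq> 0"
  shows "cong_osp q (wmon (Gk' # kword a @ ws)) (wmon (kword (a - 1) @ ws))"
proof (cases "a \<le> 0")
  case True
  then have "nat (- (a - 1)) = Suc (nat (- a))" by linarith
  with True have "Gk' # kword a = kword (a - 1)"
    by (auto simp: kword_def)
  then show ?thesis by (metis Cons_eq_appendI cong_refl)
next
  case False
  then have "nat a = Suc (nat (a - 1))" by linarith
  with False have "kword a = Gk # kword (a - 1)"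
    by (simp add: kword_def)
  then show ?thesis using cong_k'_k[OF assms] by simp
qed

text \<open>The order of the cases matters: k and k^-1 pass the letters e by induction on b, using
  the case of e; f needs all three, since exchanging it with e produces words beginning with k and
  with k^-1.\<close>

lemma pbw_spanned_gen:
  assumes q: "q \<noteq> 0"
  shows "pbw_spanned q (wmon (g # pbw_word i))"
proof -
  note Cons = pbw_spanned_Cons and cong = pbw_spanned_cong
  have e: "pbw_spanned q (wmon (Ge # pbw_word i))" for i
  proof -
    obtain b a c where "i = (b, a, c)" by (cases i)
    then show ?thesis using pbw_spanned_pbw[of "(Suc b, a, c)" q] by simp
  qed
  have k: "pbw_spanned q (wmon (Gk # pbw_word i))" for i
  proof -
    obtain b a c where i: "i = (b, a, c)" by (cases i)
    have "pbw_spanned q (wmon (Gk # replicate b Ge @ kword a @ replicate c Gf))"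
    proof (induction b)
      case 0
      then show ?case
        using cong[OF cong_k_kword[OF q]] pbw_spanned_pbw[of "(0, a + 1, c)" q] by simp
    next
      case (Suc b)
      then show ?case
        by (auto intro!: cong[OF cong_k_e[OF q]] pm.span_scale Cons[OF e])
    qed
    then show ?thesis by (simp add: i)
  qed
  have k': "pbw_spanned q (wmon (Gk' # pbw_word i))" for i
  proof -
    obtain b a c where i: "i = (b, a, c)" by (cases i)
    have "pbw_spanned q (wmon (Gk' # replicate b Ge @ kword a @ replicate c Gf))"
    proof (induction b)
      case 0
      then show ?case
        using cong[OF cong_k'_kword[OF q]] pbw_spanned_pbw[of "(0, a - 1, c)" q] by simp
    next
      case (Suc b)
      then show ?case
        by (auto intro!: cong[OF cong_k'_e[OF q]] pm.span_scale Cons[OF e])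
    qed
    then show ?thesis by (simp add: i)
  qed
  have f: "pbw_spanned q (wmon (Gf # pbw_word i))" for i
  proof -
    obtain b a c where i: "i = (b, a, c)" by (cases i)
    have *: "pbw_spanned q (wmon (Gf # replicate c Gf))"
      using pbw_spanned_pbw[of "(0, 0, Suc c)" q] by (simp add: kword_def)
    have "pbw_spanned q (wmon (Gf # replicate n Gk @ replicate c Gf))" for n
      by (induction n) (use * in \<open>auto intro!: cong[OF cong_f_k[OF q]] pm.span_scale Cons[OF k]\<close>)
    moreover have "pbw_spanned q (wmon (Gf # replicate n Gk' @ replicate c Gf))" for n
      by (induction n) (use * in \<open>auto intro!: cong[OF cong_f_k'[OF q]] pm.span_scale Cons[OF k']\<close>)
    ultimately have f0: "pbw_spanned q (wmon (Gf # kword a @ replicate c Gf))"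
      by (auto simp: kword_def)
    have "pbw_spanned q (wmon (Gf # replicate b Ge @ kword a @ replicate c Gf))"
    proof (induction b)
      case 0
      then show ?case using f0 by simp
    next
      case (Suc b)
      then show ?case
        using k[of "(b, a, c)"] k'[of "(b, a, c)"]
        by (auto intro!: cong[OF cong_f_e[OF q]] pm.span_scale pm.span_diff Cons[OF e])
    qed
    then show ?thesis by (simp add: i)
  qed
  show ?thesis using e f k k' by (cases g) auto
qed

lemma pbw_spanned:
  assumes q: "q \<noteq> 0"
  shows "pbw_spanned q a"
proof (induction a rule: poly_mapping_linear_induct)
  case (single w c)
  have "pbw_spanned q (wmon (letters w))"
  proof (induction "letters w" arbitrary: w)
    case Nil
    then show ?case using pbw_spanned_pbw[of "(0, 0, 0)" q] by (simp add: kword_def)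
  next
    case (Cons g ws)
    from Cons.hyps(1)[of "Word ws"] show ?case
      by (auto intro: pbw_spanned_Cons[OF pbw_spanned_gen[OF q]] simp flip: Cons.hyps(2))
  qed
  then have "pbw_spanned q (pscale c (wmon (letters w)))"
    by (rule pm.span_scale)
  then show ?case by (simp add: wmon_def)
qed (simp_all add: pm.span_zero pm.span_add)

lemma osp_ideal_eq_kernel:
  assumes q: "q \<noteq> 0"
  shows "osp_ideal q = {a. \<forall>i. coords q a i = 0}"
proof -
  have "pm.subspace (osp_ideal q)"
    by (simp add: pm.subspace_def osp_ideal_0 osp_ideal_add osp_ideal_pscale)
  then have "a \<in> osp_ideal q" if "\<forall>i. coords q a i = 0" for a
    by (rule kernel_of_spanning[where T = "coords q" and e = "\<lambda>i. wmon (pbw_word i)"])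
      (use pbw_spanned[OF q, of a] that in
        \<open>simp_all only: coords_add coords_pscale coords_ideal[OF q] coords_pbw\<close>)
  then show ?thesis using coords_ideal[OF q] by blast
qed

section \<open>The algebra \<open>Uq\<close> in coordinates\<close>

fun idx_parity :: "idx \<Rightarrow> bit" where
  "idx_parity (b, a, c) = of_nat (b + c)"

lemma act_parity:
  assumes "\<And>i. v i \<noteq> 0 \<Longrightarrow> idx_parity i = p" and "act q g v i \<noteq> 0"
  shows "idx_parity i = gen_parity g + p"
proof -
  obtain b a c where i: "i = (b, a, c)" by (cases i)
  have z: "v (b, a, c) = 0" if "of_nat (b + c) \<noteq> p" for b a c
    using assms(1)[of "(b, a, c)"] that by auto
  show ?thesis
  proof (rule ccontr)
    assume "idx_parity i \<noteq> gen_parity g + p"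
    then have "act q g v i = 0"
      by (cases g; cases p; cases "of_nat b :: bit"; cases "of_nat c :: bit")
        (auto simp: i z split: nat.splits)
    with assms(2) show False by simp
  qed
qed

lemma foldr_act_parity:
  "foldr (act q) ws (delta (0, 0, 0)) i \<noteq> 0 \<Longrightarrow> idx_parity i = sum_list (map gen_parity ws)"
proof (induction ws arbitrary: i)
  case Nil
  then show ?case by (auto simp: delta_def split: if_splits)
next
  case (Cons g ws)
  then show ?case using act_parity[of "foldr (act q) ws (delta (0, 0, 0))"] by simp
qed

text \<open>A word acting on 1 has its support in indices of its own parity, so the words selected
  by \<open>hpart\<close> are those that can contribute there. Hence the projection depends on
  coordinates alone and passes to \<open>Uq\<close>.\<close>

lemma coords_hpart:
  "coords q (hpart free_osp j a) i = (if idx_parity i = j then coords q a i else 0)"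
proof -
  have eq: "coords q (hpart free_osp j a) i
      = (\<Sum>w | w \<in> Poly_Mapping.keys a \<and> word_parity gen_parity w = j.
          Poly_Mapping.lookup a w * foldr (act q) (letters w) (delta (0, 0, 0)) i)"
    by (simp add: coords_def free_superalg_def rep_sum rep_single)
  have par: "word_parity gen_parity w = idx_parity i"
    if "foldr (act q) (letters w) (delta (0, 0, 0)) i \<noteq> 0" for w
    using foldr_act_parity[OF that] by (simp add: word_parity_def)
  show ?thesis
  proof (cases "idx_parity i = j")
    case True
    then show ?thesis
      unfolding eq unfolding coords_def rep_def lext_def using par
      by (simp, intro sum.mono_neutral_left) auto
  next
    case False
    then show ?thesis unfolding eq using par by (simp, intro sum.neutral) auto
  qed
qed

locale osp =
  fixes q :: complex
  assumes q_nz: "q \<noteq> 0"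
begin

sublocale U: kernel_quotient free_osp "osp_ideal q" "coords q"
  rewrites "quot_superalg free_osp (osp_ideal q) = Uq q"
proof -
  show "kernel_quotient free_osp (osp_ideal q) (coords q)"
    by unfold_locales
      (auto simp: coords_add coords_pscale osp_ideal_eq_kernel[OF q_nz])
qed (simp add: Uq_def)

abbreviation "cls a \<equiv> osp_ideal q +>\<^bsub>free_osp\<^esub> a"
abbreviation "ucoords \<equiv> qmap (coords q)"

lemma cls_eq_iff: "cls a = cls b \<longleftrightarrow> coords q a = coords q b"
  by (simp add: U.coset_eq_iff)

lemma carrier_cls [simp]: "cls a \<in> carrier (Uq q)"
  by simp

lemma carrier_clsE:
  assumes "X \<in> carrier (Uq q)"
  obtains a where "X = cls a"
  using assms by (rule U.carrier_QE)

lemma ucoords_cls [simp]: "ucoords (cls a) = coords q a"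
  by simp

lemma coords_eq_ideal: "coords q a = coords q b \<longleftrightarrow> a - b \<in> osp_ideal q"
  by (auto simp: osp_ideal_eq_kernel[OF q_nz] coords_diff fun_eq_iff)

text \<open>Two representatives of one class act alike wherever the relations hold; this is what
  makes the product, the coproduct and the counit independent of representatives.\<close>

lemma rep_cong:
  assumes "\<And>g. lin_op (act' g)" "\<And>r v i. r \<in> osp_rels q \<Longrightarrow> rep act' r v i = 0"
    and "coords q a = coords q b"
  shows "rep act' a = rep act' b"
  using rep_osp_ideal[OF assms(1,2), where a = "a - b"] assms(3)
  by (intro ext) (auto simp: coords_eq_ideal rep_diff)

lemma rep_act_cong: "coords q a = coords q b \<Longrightarrow> rep (act q) a = rep (act q) b"
  by (rule rep_cong) (simp_all add: rep_act_rels[OF q_nz])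

lemma cls_mult: "cls a \<otimes>\<^bsub>Uq q\<^esub> cls b = cls (a * b)"
  by (subst U.coset_mult) (auto simp: coords_mult dest: rep_act_cong)

lemma cls_add: "cls a \<oplus>\<^bsub>Uq q\<^esub> cls b = cls (a + b)"
  by (simp add: U.coset_add)

lemma cls_smult: "c \<odot>\<^bsub>Uq q\<^esub> cls a = cls (pscale c a)"
  by (simp add: U.coset_smult)

lemma cls_one: "\<one>\<^bsub>Uq q\<^esub> = cls 1"
  by (simp add: Uq_def quot_superalg_def)

lemma ugen_cls: "ugen q g = cls (free_gen g)"
  by (simp add: ugen_def)

lemma cls_hpart: "hpart (Uq q) j (cls a) = cls (hpart free_osp j a)"
  by (rule U.coset_hpart) (auto simp: coords_hpart fun_eq_iff)

lemma ring_Uq: "ring (Uq q)"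
proof (rule ringI)
  show "abelian_group (Uq q)" by (rule U.abelian_group_Q)
  show "monoid (Uq q)"
    by unfold_locales (auto elim!: carrier_clsE simp: cls_mult cls_one mult.assoc)
qed (auto elim!: carrier_clsE simp: cls_mult cls_add distrib_left distrib_right)

sublocale U: ring "Uq q"
  by (rule ring_Uq)

lemma hpart_closed [simp]: "X \<in> carrier (Uq q) \<Longrightarrow> hpart (Uq q) j X \<in> carrier (Uq q)"
  by (auto elim!: carrier_clsE simp: cls_hpart)

lemma ucoords_hpart:
  "X \<in> carrier (Uq q) \<Longrightarrow> ucoords (hpart (Uq q) j X) i = (if idx_parity i = j then ucoords X i else 0)"
  by (auto elim!: carrier_clsE simp: cls_hpart coords_hpart)

lemma hpart_add:
  "X \<in> carrier (Uq q) \<Longrightarrow> Y \<in> carrier (Uq q) \<Longrightarrow>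
    hpart (Uq q) j (X \<oplus>\<^bsub>Uq q\<^esub> Y) = hpart (Uq q) j X \<oplus>\<^bsub>Uq q\<^esub> hpart (Uq q) j Y"
  by (simp add: U.qmap_inj U.qmap_add ucoords_hpart)

lemma hpart_smult:
  "X \<in> carrier (Uq q) \<Longrightarrow> hpart (Uq q) j (c \<odot>\<^bsub>Uq q\<^esub> X) = c \<odot>\<^bsub>Uq q\<^esub> hpart (Uq q) j X"
  by (simp add: U.qmap_inj U.qmap_smult ucoords_hpart)

lemma smult_mult:
  assumes "X \<in> carrier (Uq q)" "Y \<in> carrier (Uq q)"
  shows "(c \<odot>\<^bsub>Uq q\<^esub> X) \<otimes>\<^bsub>Uq q\<^esub> Y = c \<odot>\<^bsub>Uq q\<^esub> (X \<otimes>\<^bsub>Uq q\<^esub> Y)"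
    and "X \<otimes>\<^bsub>Uq q\<^esub> (c \<odot>\<^bsub>Uq q\<^esub> Y) = c \<odot>\<^bsub>Uq q\<^esub> (X \<otimes>\<^bsub>Uq q\<^esub> Y)"
  using assms
  by (auto elim!: carrier_clsE simp: cls_mult cls_smult pscale_mult_left pscale_mult_right)

lemma ucoords_gen_mult:
  "Z \<in> carrier (Uq q) \<Longrightarrow> ucoords (ugen q g \<otimes>\<^bsub>Uq q\<^esub> Z) = act q g (ucoords Z)"
  by (auto elim!: carrier_clsE simp: ugen_cls cls_mult coords_mult)

end


section \<open>The tensor square in coordinates\<close>

definition bilinear_on :: "('a, 'm) superalg_scheme \<Rightarrow> ('b, 'n) superalg_scheme
    \<Rightarrow> ('a \<Rightarrow> 'b \<Rightarrow> complex) \<Rightarrow> bool" where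
  "bilinear_on A B \<beta> \<longleftrightarrow>
     (\<forall>x\<in>carrier A. \<forall>x'\<in>carrier A. \<forall>y\<in>carrier B. \<beta> (x \<oplus>\<^bsub>A\<^esub> x') y = \<beta> x y + \<beta> x' y) \<and>
     (\<forall>x\<in>carrier A. \<forall>y\<in>carrier B. \<forall>y'\<in>carrier B. \<beta> x (y \<oplus>\<^bsub>B\<^esub> y') = \<beta> x y + \<beta> x y') \<and>
     (\<forall>c. \<forall>x\<in>carrier A. \<forall>y\<in>carrier B. \<beta> (c \<odot>\<^bsub>A\<^esub> x) y = c * \<beta> x y) \<and>
     (\<forall>c. \<forall>x\<in>carrier A. \<forall>y\<in>carrier B. \<beta> x (c \<odot>\<^bsub>B\<^esub> y) = c * \<beta> x y)"

text \<open>The universal property of the tensor product in the form used here: it makes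
  \<open>tcoords\<close> vanish on the relations and later lets the product descend to the
  quotient.\<close>

lemma lext_bilinearity_span:
  assumes \<beta>: "bilinear_on A B \<beta>" and "u \<in> bilinearity_span A B"
  shows "lext (\<lambda>(x, y). \<beta> x y) u = 0"
  using assms(2) unfolding bilinearity_span_def
proof (rule pm.span_induct)
  show "pm.subspace {u. lext (\<lambda>(x, y). \<beta> x y) u = 0}"
    by (simp add: pm.subspace_def lext_add lext_pscale)
next
  fix r assume "r \<in> bilinearity_rels A B"
  then show "lext (\<lambda>(x, y). \<beta> x y) r = 0"
    using \<beta> by (auto simp: bilinearity_rels_def bilinear_on_def lext_diff)
qed

lemma lookup_keys_subset:
  "Poly_Mapping.keys (u :: 'k \<Rightarrow>\<^sub>0 complex) \<subseteq> S \<longleftrightarrow> (\<forall>k. k \<notin> S \<longrightarrow> Poly_Mapping.lookup u k = 0)"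
  by (auto simp: in_keys_iff)

lemma subspace_keys_subset: "pm.subspace {u. Poly_Mapping.keys u \<subseteq> S}"
  by (auto simp: pm.subspace_def lookup_keys_subset lookup_add)

lemma bilinearity_span_carrier:
  assumes "\<And>x x'. x \<in> carrier A \<Longrightarrow> x' \<in> carrier A \<Longrightarrow> x \<oplus>\<^bsub>A\<^esub> x' \<in> carrier A"
    and "\<And>c x. x \<in> carrier A \<Longrightarrow> c \<odot>\<^bsub>A\<^esub> x \<in> carrier A"
    and "\<And>x x'. x \<in> carrier B \<Longrightarrow> x' \<in> carrier B \<Longrightarrow> x \<oplus>\<^bsub>B\<^esub> x' \<in> carrier B"
    and "\<And>c x. x \<in> carrier B \<Longrightarrow> c \<odot>\<^bsub>B\<^esub> x \<in> carrier B"
  shows "bilinearity_span A B \<subseteq> {u. Poly_Mapping.keys u \<subseteq> carrier A \<times> carrier B}"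
  unfolding bilinearity_span_def
proof (rule pm.span_minimal[OF _ subspace_keys_subset], rule subsetI)
  fix r assume "r \<in> bilinearity_rels A B"
  then show "r \<in> {u. Poly_Mapping.keys u \<subseteq> carrier A \<times> carrier B}"
    using assms
    unfolding bilinearity_rels_def lookup_keys_subset
    by (auto simp: lookup_minus lookup_single when_def)
qed

lemma bilinearity_span_rels:
  shows "x \<in> carrier A \<Longrightarrow> x' \<in> carrier A \<Longrightarrow> y \<in> carrier B \<Longrightarrow>
      Poly_Mapping.single (x \<oplus>\<^bsub>A\<^esub> x', y) 1 - Poly_Mapping.single (x, y) 1
        - Poly_Mapping.single (x', y) 1 \<in> bilinearity_span A B"
    and "x \<in> carrier A \<Longrightarrow> y \<in> carrier B \<Longrightarrow> y' \<in> carrier B \<Longrightarrow>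
      Poly_Mapping.single (x, y \<oplus>\<^bsub>B\<^esub> y') 1 - Poly_Mapping.single (x, y) 1
        - Poly_Mapping.single (x, y') 1 \<in> bilinearity_span A B"
    and "x \<in> carrier A \<Longrightarrow> y \<in> carrier B \<Longrightarrow>
      Poly_Mapping.single (c \<odot>\<^bsub>A\<^esub> x, y) 1 - Poly_Mapping.single (x, y) c \<in> bilinearity_span A B"
    and "x \<in> carrier A \<Longrightarrow> y \<in> carrier B \<Longrightarrow>
      Poly_Mapping.single (x, c \<odot>\<^bsub>B\<^esub> y) 1 - Poly_Mapping.single (x, y) c \<in> bilinearity_span A B"
  unfolding bilinearity_span_def
  by (rule pm.span_base, simp only: bilinearity_rels_def, blast)+

context osp
begin

abbreviation "UV \<equiv> pretensor (Uq q) (Uq q)"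
abbreviation "brels \<equiv> bilinearity_span (Uq q) (Uq q)"

definition tcoords :: "((gen word \<Rightarrow>\<^sub>0 complex) set \<times> (gen word \<Rightarrow>\<^sub>0 complex) set \<Rightarrow>\<^sub>0 complex)
    \<Rightarrow> idx \<times> idx \<Rightarrow> complex" where
  "tcoords u = (\<lambda>(i, j). lext (\<lambda>(x, y). ucoords x i * ucoords y j) u)"

lemma tcoords_add: "tcoords (u + v) p = tcoords u p + tcoords v p"
  and tcoords_diff: "tcoords (u - v) p = tcoords u p - tcoords v p"
  and tcoords_pscale: "tcoords (pscale c u) p = c * tcoords u p"
  by (auto simp: tcoords_def lext_add lext_diff lext_pscale split: prod.split)

lemma tcoords_single:
  "tcoords (Poly_Mapping.single (x, y) c) (i, j) = c * (ucoords x i * ucoords y j)"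
  by (simp add: tcoords_def)

lemma tcoords_brels:
  assumes "u \<in> brels"
  shows "tcoords u p = 0"
proof -
  obtain i j where p: "p = (i, j)" by (cases p)
  have "bilinear_on (Uq q) (Uq q) (\<lambda>x y. ucoords x i * ucoords y j)"
    unfolding bilinear_on_def by (simp add: U.qmap_add U.qmap_smult algebra_simps)
  from lext_bilinearity_span[OF this assms] show ?thesis
    by (simp add: p tcoords_def)
qed

abbreviation "pbw_cls i \<equiv> cls (wmon (pbw_word i))"

lemma tcoords_pbw: "tcoords (Poly_Mapping.single (pbw_cls i, pbw_cls j) 1) = delta (i, j)"
proof
  fix p
  show "tcoords (Poly_Mapping.single (pbw_cls i, pbw_cls j) 1) p = delta (i, j) p"
    by (cases p) (simp add: tcoords_single, simp add: delta_def)
qed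

text \<open>PBW spanning is applied by span induction in one factor at a time: first on the right
  with a basis vector on the left, then on the left. The bilinearity relations absorb each sum and
  scalar.\<close>

lemma tensor_spanned:
  "Poly_Mapping.single (cls a, cls b) 1 \<in>
     pm.span (range (\<lambda>(i, j). Poly_Mapping.single (pbw_cls i, pbw_cls j) 1) \<union> brels)"
  (is "_ \<in> ?M")
proof -
  have brels: "u \<in> ?M" if "u \<in> brels" for u
    using that by (auto intro: pm.span_base)
  have trans: "u \<in> ?M" if "u - v \<in> brels" "v \<in> ?M" for u v
    using pm.span_add[OF brels that(2), of "u - v"] that(1) by simp
  have right: "Poly_Mapping.single (x, cls b) 1 \<in> ?M"
    if x: "x \<in> carrier (Uq q)" and *: "\<And>j. Poly_Mapping.single (x, pbw_cls j) 1 \<in> ?M" for x b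
    using pbw_spanned[OF q_nz, of b]
  proof (rule pm.span_induct)
    \<comment> \<open>Homogeneity with scalar 0 puts x \<otimes> 0 into the span; this also covers
      \<open>b\<close> in the ideal, where \<open>cls b = cls 0\<close>.\<close>
    have zero: "Poly_Mapping.single (x, cls 0) 1 \<in> ?M"
      using bilinearity_span_rels(4)[OF x carrier_cls[of 0], of 0] by (auto simp: cls_smult intro: brels)
    show "pm.subspace {b. Poly_Mapping.single (x, cls b) 1 \<in> ?M}"
    proof (rule pm.subspaceI)
      fix a b assume "a \<in> {b. Poly_Mapping.single (x, cls b) 1 \<in> ?M}"
        "b \<in> {b. Poly_Mapping.single (x, cls b) 1 \<in> ?M}"
      then have "Poly_Mapping.single (x, cls a) 1 + Poly_Mapping.single (x, cls b) 1 \<in> ?M"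
        by (auto intro: pm.span_add)
      then show "a + b \<in> {b. Poly_Mapping.single (x, cls b) 1 \<in> ?M}"
        using bilinearity_span_rels(2)[OF x carrier_cls[of a] carrier_cls[of b]]
        by (auto simp: cls_add algebra_simps intro: trans)
    next
      fix c a assume "a \<in> {b. Poly_Mapping.single (x, cls b) 1 \<in> ?M}"
      then have "pscale c (Poly_Mapping.single (x, cls a) 1) \<in> ?M"
        by (blast intro: pm.span_scale)
      then show "pscale c a \<in> {b. Poly_Mapping.single (x, cls b) 1 \<in> ?M}"
        using bilinearity_span_rels(4)[OF x carrier_cls[of a], of c]
        by (auto simp: cls_smult intro: trans)
    qed (use zero in simp)
    fix b assume "b \<in> range (\<lambda>i. wmon (pbw_word i)) \<union> osp_ideal q"
    moreover have "cls b = cls 0" if "b \<in> osp_ideal q"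
      using that by (simp add: cls_eq_iff coords_eq_ideal)
    ultimately show "Poly_Mapping.single (x, cls b) 1 \<in> ?M"
      using * zero by fastforce
  qed
  have left: "Poly_Mapping.single (cls a, y) 1 \<in> ?M"
    if x: "y \<in> carrier (Uq q)" and *: "\<And>j. Poly_Mapping.single (pbw_cls j, y) 1 \<in> ?M" for y a
    using pbw_spanned[OF q_nz, of a]
  proof (rule pm.span_induct)
    have zero: "Poly_Mapping.single (cls 0, y) 1 \<in> ?M"
      using bilinearity_span_rels(3)[OF carrier_cls[of 0] x, of 0] by (auto simp: cls_smult intro: brels)
    show "pm.subspace {a. Poly_Mapping.single (cls a, y) 1 \<in> ?M}"
    proof (rule pm.subspaceI)
      fix a b assume "a \<in> {b. Poly_Mapping.single (cls b, y) 1 \<in> ?M}"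
        "b \<in> {b. Poly_Mapping.single (cls b, y) 1 \<in> ?M}"
      then have "Poly_Mapping.single (cls a, y) 1 + Poly_Mapping.single (cls b, y) 1 \<in> ?M"
        by (auto intro: pm.span_add)
      then show "a + b \<in> {b. Poly_Mapping.single (cls b, y) 1 \<in> ?M}"
        using bilinearity_span_rels(1)[OF carrier_cls[of a] carrier_cls[of b] x]
        by (auto simp: cls_add algebra_simps intro: trans)
    next
      fix c a assume "a \<in> {b. Poly_Mapping.single (cls b, y) 1 \<in> ?M}"
      then have "pscale c (Poly_Mapping.single (cls a, y) 1) \<in> ?M"
        by (blast intro: pm.span_scale)
      then show "pscale c a \<in> {b. Poly_Mapping.single (cls b, y) 1 \<in> ?M}"
        using bilinearity_span_rels(3)[OF carrier_cls[of a] x, of c]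
        by (auto simp: cls_smult intro: trans)
    qed (use zero in simp)
    fix b assume "b \<in> range (\<lambda>i. wmon (pbw_word i)) \<union> osp_ideal q"
    moreover have "cls b = cls 0" if "b \<in> osp_ideal q"
      using that by (simp add: cls_eq_iff coords_eq_ideal)
    ultimately show "Poly_Mapping.single (cls b, y) 1 \<in> ?M"
      using * zero by fastforce
  qed
  have base: "Poly_Mapping.single (pbw_cls i, pbw_cls j) 1 \<in> ?M" for i j
    by (rule pm.span_base) auto
  show ?thesis
    by (rule left[OF carrier_cls right[OF carrier_cls base]])
qed

lemma pretensor_simps [simp]:
  "carrier UV = {u. Poly_Mapping.keys u \<subseteq> carrier (Uq q) \<times> carrier (Uq q)}"
  "add UV = (+)" "zero UV = 0" "smult UV = pscale"
  "one UV = Poly_Mapping.single (\<one>\<^bsub>Uq q\<^esub>, \<one>\<^bsub>Uq q\<^esub>) 1"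
  by (simp_all add: pretensor_def)

lemma tensor_kernel: "brels = {u \<in> carrier UV. \<forall>p. tcoords u p = 0}"
proof (intro equalityI subsetI)
  fix u assume "u \<in> brels"
  moreover have "brels \<subseteq> carrier UV"
    by (simp only: pretensor_simps) (rule bilinearity_span_carrier, auto)
  ultimately show "u \<in> {u \<in> carrier UV. \<forall>p. tcoords u p = 0}"
    using tcoords_brels by blast
next
  fix u assume u: "u \<in> {u \<in> carrier UV. \<forall>p. tcoords u p = 0}"
  let ?e = "\<lambda>(i, j). Poly_Mapping.single (pbw_cls i, pbw_cls j) (1 :: complex)"
  have "u \<in> pm.span (range ?e \<union> brels)"
  proof (induction u rule: poly_mapping_linear_induct)
    case (single k c)
    with u obtain a b where "k = (cls a, cls b)"
      by (auto elim!: carrier_clsE)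
    then show ?case
      using pm.span_scale[OF tensor_spanned[of a b], of c] by simp
  qed (auto intro: pm.span_zero pm.span_add)
  then show "u \<in> brels"
  proof (rule kernel_of_spanning[where T = tcoords, rotated 5])
    show "pm.subspace brels"
      unfolding bilinearity_span_def by (rule pm.subspace_span)
    show "tcoords (?e p) = delta p" for p
      by (cases p) (simp only: prod.case tcoords_pbw)
  qed (simp_all only: tcoords_add tcoords_pscale tcoords_brels, use u in blast)
qed

sublocale UU: kernel_quotient UV brels tcoords
  rewrites "quot_superalg UV brels = UU q"
proof -
  show "kernel_quotient UV brels tcoords"
    by (standard)
      (use subspace_keys_subset[of "carrier (Uq q) \<times> carrier (Uq q)"] in
        \<open>auto simp: tcoords_add tcoords_pscale tensor_kernel pm.subspace_def lookup_keys_subset\<close>)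
qed (simp add: tensor_superalg_def)

end

section \<open>The comultiplication in coordinates\<close>

text \<open>Operators on one tensor factor, free of signs; all signs of the graded product are kept
  in \<open>twist\<close>.\<close>

definition on1 :: "(('i \<Rightarrow> complex) \<Rightarrow> 'i \<Rightarrow> complex) \<Rightarrow> ('i \<times> 'j \<Rightarrow> complex) \<Rightarrow> 'i \<times> 'j \<Rightarrow> complex" where
  "on1 L u = (\<lambda>(i, j). L (\<lambda>i'. u (i', j)) i)"

definition on2 :: "(('j \<Rightarrow> complex) \<Rightarrow> 'j \<Rightarrow> complex) \<Rightarrow> ('i \<times> 'j \<Rightarrow> complex) \<Rightarrow> 'i \<times> 'j \<Rightarrow> complex" where
  "on2 L u = (\<lambda>(i, j). L (\<lambda>j'. u (i, j')) j)"

text \<open>Left multiplication by x \<otimes> y with y of parity p sends z \<otimes> w to (-1)^(p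
  p(z)) xz \<otimes> yw, so the sign depends on the first index alone and is applied before x and y
  act.\<close>

definition twist :: "bit \<Rightarrow> (idx \<times> 'j \<Rightarrow> complex) \<Rightarrow> idx \<times> 'j \<Rightarrow> complex" where
  "twist p u = (\<lambda>(i, j). koszul p (idx_parity i) * u (i, j))"

text \<open>Left multiplication by \<Delta>(g); \<open>twist 1\<close> stands with the summands k
  \<otimes> e and 1 \<otimes> f, whose right factor is odd.\<close>

fun act2 :: "complex \<Rightarrow> gen \<Rightarrow> (idx \<times> idx \<Rightarrow> complex) \<Rightarrow> idx \<times> idx \<Rightarrow> complex" where
  "act2 q Gk u p = on1 (act q Gk) (on2 (act q Gk) u) p"
| "act2 q Gk' u p = on1 (act q Gk') (on2 (act q Gk') u) p"
| "act2 q Ge u p = on1 (act q Ge) u p + on1 (act q Gk) (on2 (act q Ge) (twist 1 u)) p"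
| "act2 q Gf u p = on1 (act q Gf) (on2 (act q Gk') u) p + on2 (act q Gf) (twist 1 u) p"

lemma on1_linear:
  assumes "lin_op L"
  shows "on1 L (\<lambda>p. u p + v p) = (\<lambda>p. on1 L u p + on1 L v p)"
    "on1 L (\<lambda>p. u p - v p) = (\<lambda>p. on1 L u p - on1 L v p)"
    "on1 L (\<lambda>p. c * u p) = (\<lambda>p. c * on1 L u p)"
proof -
  show "on1 L (\<lambda>p. u p + v p) = (\<lambda>p. on1 L u p + on1 L v p)"
    and scale: "on1 L (\<lambda>p. c * u p) = (\<lambda>p. c * on1 L u p)" for u v c
    by (auto simp: on1_def lin_op_add[OF assms] lin_op_scale[OF assms])
  from this(1)[of u "\<lambda>p. - 1 * v p"] this(2)[of "- 1" v]
  show "on1 L (\<lambda>p. u p - v p) = (\<lambda>p. on1 L u p - on1 L v p)"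
    by simp
qed

lemma on2_linear:
  assumes "lin_op L"
  shows "on2 L (\<lambda>p. u p + v p) = (\<lambda>p. on2 L u p + on2 L v p)"
    "on2 L (\<lambda>p. u p - v p) = (\<lambda>p. on2 L u p - on2 L v p)"
    "on2 L (\<lambda>p. c * u p) = (\<lambda>p. c * on2 L u p)"
proof -
  show "on2 L (\<lambda>p. u p + v p) = (\<lambda>p. on2 L u p + on2 L v p)"
    and scale: "on2 L (\<lambda>p. c * u p) = (\<lambda>p. c * on2 L u p)" for u v c
    by (auto simp: on2_def lin_op_add[OF assms] lin_op_scale[OF assms])
  from this(1)[of u "\<lambda>p. - 1 * v p"] this(2)[of "- 1" v]
  show "on2 L (\<lambda>p. u p - v p) = (\<lambda>p. on2 L u p - on2 L v p)"
    by simp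
qed

lemma twist_linear:
  "twist s (\<lambda>p. u p + v p) = (\<lambda>p. twist s u p + twist s v p)"
  "twist s (\<lambda>p. u p - v p) = (\<lambda>p. twist s u p - twist s v p)"
  "twist s (\<lambda>p. c * u p) = (\<lambda>p. c * twist s u p)"
  by (auto simp: twist_def algebra_simps)

lemma twist_twist: "twist s (twist s u) = u"
  by (auto simp: twist_def koszul_def)

lemma twist_on2:
  assumes "lin_op L"
  shows "twist s (on2 L u) = on2 L (twist s u)"
  by (auto simp: twist_def on2_def lin_op_scale[OF assms])

text \<open>An odd operator changes the parity of the first index, so moving \<open>twist\<close>
  inside it costs a sign.\<close>

lemma twist_on1_act:
  "twist 1 (on1 (act q g) u) = (\<lambda>p. koszul 1 (gen_parity g) * on1 (act q g) (twist 1 u) p)"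
proof (rule ext, clarify)
  fix b a c j
  show "twist 1 (on1 (act q g) u) ((b, a, c), j)
      = koszul 1 (gen_parity g) * on1 (act q g) (twist 1 u) ((b, a, c), j)"
    by (cases g; cases "of_nat b :: bit"; cases "of_nat c :: bit")
      (auto simp: twist_def on1_def koszul_def algebra_simps divide_inverse split: nat.splits)
qed

lemma on2_on1_act: "on2 (act q h) (on1 (act q g) u) = on1 (act q g) (on2 (act q h) u)"
proof (rule ext, clarify)
  fix b a c b' a' c'
  show "on2 (act q h) (on1 (act q g) u) ((b, a, c), (b', a', c'))
      = on1 (act q g) (on2 (act q h) u) ((b, a, c), (b', a', c'))"
    unfolding on1_def on2_def
    by (cases g; cases h; cases c; cases c')
      (simp_all add: divide_inverse algebra_simps split: nat.split)
qed

text \<open>The relations oriented as rewrite rules towards the order e, k, f. They are equations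
  between functions, so that \<open>on1\<close> and \<open>on2\<close> inherit them.\<close>

lemma act_normal_order:
  assumes "q \<noteq> 0"
  shows "act q Gk (act q Gk' v) = v" "act q Gk' (act q Gk v) = v"
    "act q Gk (act q Ge v) = (\<lambda>i. q * act q Ge (act q Gk v) i)"
    "act q Gk' (act q Ge v) = (\<lambda>i. inverse q * act q Ge (act q Gk' v) i)"
    "act q Gf (act q Gk v) = (\<lambda>i. q * act q Gk (act q Gf v) i)"
    "act q Gf (act q Gk' v) = (\<lambda>i. inverse q * act q Gk' (act q Gf v) i)"
    "act q Gf (act q Ge v)
      = (\<lambda>i. inverse (q - inverse q) * (act q Gk v i - act q Gk' v i) - act q Ge (act q Gf v) i)"
proof -
  note [simp] = lin_op_scale[OF lin_op_act]
  show k: "act q Gk (act q Gk' v) = v" "act q Gk' (act q Gk v) = v" for v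
    using act_relations(1,2)[OF assms] by auto
  have ke: "act q Gk (act q Ge (act q Gk' v)) = (\<lambda>i. q * act q Ge v i)"
    and kf: "act q Gk (act q Gf (act q Gk' v)) = (\<lambda>i. inverse q * act q Gf v i)" for v
    using act_relations(3,4)[OF assms] by auto
  show "act q Gk (act q Ge v) = (\<lambda>i. q * act q Ge (act q Gk v) i)"
    using ke[of "act q Gk v"] by (simp add: k)
  have "act q Gk' (\<lambda>i. q * act q Ge v i) = act q Ge (act q Gk' v)"
    using arg_cong[OF ke[of v], of "act q Gk'"] by (simp add: k)
  then have "q * act q Gk' (act q Ge v) i = act q Ge (act q Gk' v) i" for i
    using lin_op_scale[OF lin_op_act, of q Gk' q "act q Ge v" i] by simp
  then show "act q Gk' (act q Ge v) = (\<lambda>i. inverse q * act q Ge (act q Gk' v) i)"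
    using assms by (auto simp: field_simps)
  have "act q Gk (act q Gf v) = (\<lambda>i. inverse q * act q Gf (act q Gk v) i)"
    using kf[of "act q Gk v"] by (simp add: k)
  then show "act q Gf (act q Gk v) = (\<lambda>i. q * act q Gk (act q Gf v) i)"
    using assms by (auto simp: field_simps)
  have "act q Gk' (\<lambda>i. inverse q * act q Gf v i) = act q Gf (act q Gk' v)"
    using arg_cong[OF kf[of v], of "act q Gk'"] by (simp add: k)
  then show "act q Gf (act q Gk' v) = (\<lambda>i. inverse q * act q Gk' (act q Gf v) i)"
    using lin_op_scale[OF lin_op_act, of q Gk' "inverse q" "act q Gf v"] by auto
  show "act q Gf (act q Ge v)
      = (\<lambda>i. inverse (q - inverse q) * (act q Gk v i - act q Gk' v i) - act q Ge (act q Gf v) i)"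
    by (rule ext) (use act_relations(5)[OF assms, of v] in
      \<open>simp add: eq_diff_eq add.commute divide_inverse mult.commute del: act.simps\<close>)
qed

lemma on1_normal_order:
  assumes "q \<noteq> 0"
  shows "on1 (act q Gk) (on1 (act q Gk') v) = v" "on1 (act q Gk') (on1 (act q Gk) v) = v"
    "on1 (act q Gk) (on1 (act q Ge) v) = (\<lambda>i. q * on1 (act q Ge) (on1 (act q Gk) v) i)"
    "on1 (act q Gk') (on1 (act q Ge) v) = (\<lambda>i. inverse q * on1 (act q Ge) (on1 (act q Gk') v) i)"
    "on1 (act q Gf) (on1 (act q Gk) v) = (\<lambda>i. q * on1 (act q Gk) (on1 (act q Gf) v) i)"
    "on1 (act q Gf) (on1 (act q Gk') v) = (\<lambda>i. inverse q * on1 (act q Gk') (on1 (act q Gf) v) i)"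
    "on1 (act q Gf) (on1 (act q Ge) v)
      = (\<lambda>i. inverse (q - inverse q) * (on1 (act q Gk) v i - on1 (act q Gk') v i)
          - on1 (act q Ge) (on1 (act q Gf) v) i)"
  by (simp_all add: on1_def act_normal_order[OF assms] fun_eq_iff del: act.simps)

lemma on2_normal_order:
  assumes "q \<noteq> 0"
  shows "on2 (act q Gk) (on2 (act q Gk') v) = v" "on2 (act q Gk') (on2 (act q Gk) v) = v"
    "on2 (act q Gk) (on2 (act q Ge) v) = (\<lambda>i. q * on2 (act q Ge) (on2 (act q Gk) v) i)"
    "on2 (act q Gk') (on2 (act q Ge) v) = (\<lambda>i. inverse q * on2 (act q Ge) (on2 (act q Gk') v) i)"
    "on2 (act q Gf) (on2 (act q Gk) v) = (\<lambda>i. q * on2 (act q Gk) (on2 (act q Gf) v) i)"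
    "on2 (act q Gf) (on2 (act q Gk') v) = (\<lambda>i. inverse q * on2 (act q Gk') (on2 (act q Gf) v) i)"
    "on2 (act q Gf) (on2 (act q Ge) v)
      = (\<lambda>i. inverse (q - inverse q) * (on2 (act q Gk) v i - on2 (act q Gk') v i)
          - on2 (act q Ge) (on2 (act q Gf) v) i)"
  by (simp_all add: on2_def act_normal_order[OF assms] fun_eq_iff del: act.simps)

lemma lin_op_act2 [simp]: "lin_op (act2 q g)"
  unfolding lin_op_def
  by (cases g) (simp_all add: on1_linear on2_linear twist_linear distrib_left)

lemma act2_fun:
  "act2 q Gk u = on1 (act q Gk) (on2 (act q Gk) u)"
  "act2 q Gk' u = on1 (act q Gk') (on2 (act q Gk') u)"
  "act2 q Ge u = (\<lambda>p. on1 (act q Ge) u p + on1 (act q Gk) (on2 (act q Ge) (twist 1 u)) p)"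
  "act2 q Gf u = (\<lambda>p. on1 (act q Gf) (on2 (act q Gk') u) p + on2 (act q Gf) (twist 1 u) p)"
  by (rule ext, simp)+

text \<open>\<Delta> respects the relations. Rewriting brings both sides to a form with
  \<open>on1\<close> outside \<open>on2\<close>, each in the order e, k, f, and \<open>twist\<close>
  innermost. In the last relation the mixed terms cancel, and (k - k^-1) \<otimes> k^-1 + k
  \<otimes> (k - k^-1) telescopes.\<close>

lemma rep_act2_rels:
  assumes q: "q \<noteq> 0" and "r \<in> osp_rels q"
  shows "rep (act2 q) r v p = 0"
proof -
  have inv: "q * (inverse q * x) = x" for x
    using q by simp
  note rules = inv act2_fun on1_linear on2_linear twist_linear twist_on2 twist_on1_act twist_twist
    on2_on1_act on1_normal_order[OF q] on2_normal_order[OF q] koszul_def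
  have "act2 q Gk (act2 q Gk' v) p = v p" "act2 q Gk' (act2 q Gk v) p = v p"
    by (simp_all add: rules del: act2.simps)
  moreover have "act2 q Gk (act2 q Ge (act2 q Gk' v)) p = q * act2 q Ge v p"
    using q by (simp add: rules algebra_simps del: act2.simps)
  moreover have "act2 q Gk (act2 q Gf (act2 q Gk' v)) p = inverse q * act2 q Gf v p"
    using q by (simp add: rules algebra_simps del: act2.simps)
  moreover have "act2 q Ge (act2 q Gf v) p + act2 q Gf (act2 q Ge v) p
      = inverse (q - inverse q) * (act2 q Gk v p - act2 q Gk' v p)"
    using q by (simp add: rules algebra_simps del: act2.simps)
  ultimately show ?thesis
    using assms(2)
    by (auto simp: osp_rels_def Let_def rep_diff rep_add rep_mult rep_pscale mult.assoc divide_inverse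
      simp del: act2.simps)
qed

section \<open>The product of the tensor square in coordinates\<close>

lemma bilinear_on_lext:
  assumes "\<And>k. k \<in> Poly_Mapping.keys v \<Longrightarrow> bilinear_on A B (\<beta> k)"
  shows "bilinear_on A B (\<lambda>x y. lext (\<lambda>k. \<beta> k x y) v)"
  using assms unfolding bilinear_on_def lext_def
  by (simp add: sum.distrib sum_distrib_left algebra_simps)

lemma bilinear_on_sum:
  assumes "\<And>k. k \<in> S \<Longrightarrow> bilinear_on A B (\<beta> k)"
  shows "bilinear_on A B (\<lambda>x y. \<Sum>k\<in>S. c k * \<beta> k x y)"
  using assms unfolding bilinear_on_def
  by (simp add: sum.distrib sum_distrib_left algebra_simps)

context osp
begin

lemma ucoords_mult_add_left:
  assumes "X \<in> carrier (Uq q)" "X' \<in> carrier (Uq q)" "Y \<in> carrier (Uq q)"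
  shows "ucoords ((X \<oplus>\<^bsub>Uq q\<^esub> X') \<otimes>\<^bsub>Uq q\<^esub> Y) i
    = ucoords (X \<otimes>\<^bsub>Uq q\<^esub> Y) i + ucoords (X' \<otimes>\<^bsub>Uq q\<^esub> Y) i"
  using assms by (simp add: U.l_distr U.qmap_add)

lemma ucoords_mult_add_right:
  assumes "X \<in> carrier (Uq q)" "Y \<in> carrier (Uq q)" "Y' \<in> carrier (Uq q)"
  shows "ucoords (X \<otimes>\<^bsub>Uq q\<^esub> (Y \<oplus>\<^bsub>Uq q\<^esub> Y')) i
    = ucoords (X \<otimes>\<^bsub>Uq q\<^esub> Y) i + ucoords (X \<otimes>\<^bsub>Uq q\<^esub> Y') i"
  using assms by (simp add: U.r_distr U.qmap_add)

text \<open>The coordinate (I, J) of the product (x, y) (z, w). The descent of the product to the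
  quotient rests on its bilinearity in (x, y) and in (z, w).\<close>

definition mult_form :: "idx \<Rightarrow> idx \<Rightarrow> (gen word \<Rightarrow>\<^sub>0 complex) set \<Rightarrow> (gen word \<Rightarrow>\<^sub>0 complex) set
    \<Rightarrow> (gen word \<Rightarrow>\<^sub>0 complex) set \<Rightarrow> (gen word \<Rightarrow>\<^sub>0 complex) set \<Rightarrow> complex" where
  "mult_form I J x y z w = (\<Sum>(i, j)\<in>{0, 1} \<times> {0, 1}. koszul i j *
     (ucoords (x \<otimes>\<^bsub>Uq q\<^esub> hpart (Uq q) j z) I * ucoords (hpart (Uq q) i y \<otimes>\<^bsub>Uq q\<^esub> w) J))"

lemma mult_form_bilinear_left:
  assumes "z \<in> carrier (Uq q)" "w \<in> carrier (Uq q)"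
  shows "bilinear_on (Uq q) (Uq q) (\<lambda>x y. mult_form I J x y z w)"
  unfolding mult_form_def case_prod_unfold
  by (rule bilinear_on_sum, unfold bilinear_on_def)
    (use assms in \<open>simp add: ucoords_mult_add_left hpart_add hpart_smult smult_mult U.qmap_smult
      algebra_simps\<close>)

lemma mult_form_bilinear_right:
  assumes "x \<in> carrier (Uq q)" "y \<in> carrier (Uq q)"
  shows "bilinear_on (Uq q) (Uq q) (\<lambda>z w. mult_form I J x y z w)"
  unfolding mult_form_def case_prod_unfold
  by (rule bilinear_on_sum, unfold bilinear_on_def)
    (use assms in \<open>simp add: ucoords_mult_add_right hpart_add hpart_smult smult_mult U.qmap_smult
      algebra_simps\<close>)

lemma tcoords_sum: "tcoords (\<Sum>x\<in>X. h x) p = (\<Sum>x\<in>X. tcoords (h x) p)"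
  by (cases p) (simp add: tcoords_def lext_sum)

lemma UV_mult:
  "u \<otimes>\<^bsub>UV\<^esub> v = (\<Sum>k\<in>Poly_Mapping.keys u. \<Sum>l\<in>Poly_Mapping.keys v. \<Sum>i\<in>{0, 1}. \<Sum>j\<in>{0, 1}.
     Poly_Mapping.single (fst k \<otimes>\<^bsub>Uq q\<^esub> hpart (Uq q) j (fst l), hpart (Uq q) i (snd k) \<otimes>\<^bsub>Uq q\<^esub> snd l)
       (koszul i j * Poly_Mapping.lookup u k * Poly_Mapping.lookup v l))"
  by (simp only: pretensor_def monoid.simps case_prod_unfold prod.collapse)

lemma tcoords_mult:
  "tcoords (u \<otimes>\<^bsub>UV\<^esub> v) (I, J)
    = lext (\<lambda>k. lext (\<lambda>l. mult_form I J (fst k) (snd k) (fst l) (snd l)) v) u"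
  unfolding UV_mult tcoords_sum tcoords_single lext_def mult_form_def case_prod_unfold
    sum.cartesian_product[symmetric, of _ "{0, 1}", unfolded case_prod_unfold] sum_distrib_left
  by (intro sum.cong refl) (simp add: mult_ac)

lemma UV_mult_closed:
  assumes "u \<in> carrier UV" "v \<in> carrier UV"
  shows "u \<otimes>\<^bsub>UV\<^esub> v \<in> carrier UV"
proof -
  have single: "Poly_Mapping.single (x, y) c \<in> carrier UV"
    if "x \<in> carrier (Uq q)" "y \<in> carrier (Uq q)" for x y c
    using that by (simp add: lookup_keys_subset lookup_single when_def)
  have sum: "(\<Sum>x\<in>X. h x) \<in> carrier UV" if "\<And>x. x \<in> X \<Longrightarrow> h x \<in> carrier UV"
    for X :: "'x set" and h
    using pm.subspace_sum[OF subspace_keys_subset, of X h] that by simp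
  show ?thesis
    unfolding UV_mult
    by (intro sum single U.m_closed hpart_closed) (use assms in auto)
qed

text \<open>One factor is replaced at a time. With the right factor fixed, the difference of the
  left factors lies in the bilinearity span, where a bilinear form gives 0; then the right factor is
  replaced, for each key of \<open>u'\<close>.\<close>

lemma UV_mult_cong:
  assumes "u \<in> carrier UV" "u' \<in> carrier UV" "v \<in> carrier UV" "v' \<in> carrier UV"
    and "tcoords u = tcoords u'" "tcoords v = tcoords v'"
  shows "tcoords (u \<otimes>\<^bsub>UV\<^esub> v) = tcoords (u' \<otimes>\<^bsub>UV\<^esub> v')"
proof
  fix p :: "idx \<times> idx"
  obtain I J where p: "p = (I, J)" by (cases p)
  let ?f = "\<lambda>u v. lext (\<lambda>k. lext (\<lambda>l. mult_form I J (fst k) (snd k) (fst l) (snd l)) v) u"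
  have diff: "u - u' \<in> brels" "v - v' \<in> brels"
    using assms UU.diff_closed by (auto simp: tensor_kernel tcoords_diff simp del: pretensor_simps)
  have "bilinear_on (Uq q) (Uq q) (\<lambda>x y. lext (\<lambda>l. mult_form I J x y (fst l) (snd l)) v)"
    by (rule bilinear_on_lext, rule mult_form_bilinear_left) (use assms in auto)
  from lext_bilinearity_span[OF this diff(1)] have "?f u v = ?f u' v"
    by (simp add: case_prod_unfold lext_diff)
  also have "\<dots> = ?f u' v'"
  proof (rule lext_cong)
    fix k assume "k \<in> Poly_Mapping.keys u'"
    with assms have "fst k \<in> carrier (Uq q)" "snd k \<in> carrier (Uq q)" by auto
    from lext_bilinearity_span[OF mult_form_bilinear_right[OF this] diff(2)]
    show "lext (\<lambda>l. mult_form I J (fst k) (snd k) (fst l) (snd l)) v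
        = lext (\<lambda>l. mult_form I J (fst k) (snd k) (fst l) (snd l)) v'"
      by (simp add: lext_diff case_prod_unfold)
  qed
  finally show "tcoords (u \<otimes>\<^bsub>UV\<^esub> v) p = tcoords (u' \<otimes>\<^bsub>UV\<^esub> v') p"
    by (simp only: p tcoords_mult)
qed

lemma UU_mult:
  assumes "u \<in> carrier UV" "v \<in> carrier UV"
  shows "UU.coset u \<otimes>\<^bsub>UU q\<^esub> UU.coset v = UU.coset (u \<otimes>\<^bsub>UV\<^esub> v)"
  using assms by (intro UU.coset_mult conjI UV_mult_closed UV_mult_cong)

text \<open>As y is homogeneous of parity s, only the summand i = s of the product survives. The sum
  over j runs over the even and odd parts of z and recombines to z with the sign of
  \<open>twist\<close>.\<close>

lemma tcoords_single_mult:
  assumes x: "x \<in> carrier (Uq q)" "\<And>z. z \<in> carrier (Uq q) \<Longrightarrow> ucoords (x \<otimes>\<^bsub>Uq q\<^esub> z) = L (ucoords z)"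
    and y: "y \<in> carrier (Uq q)" "\<And>w. w \<in> carrier (Uq q) \<Longrightarrow> ucoords (y \<otimes>\<^bsub>Uq q\<^esub> w) = M (ucoords w)"
    and lin: "lin_op L" "lin_op M"
    and hp: "\<And>i. hpart (Uq q) i y = (if i = s then y else \<zero>\<^bsub>Uq q\<^esub>)"
    and v: "v \<in> carrier UV"
  shows "tcoords (Poly_Mapping.single (x, y) 1 \<otimes>\<^bsub>UV\<^esub> v) = on1 L (on2 M (twist s (tcoords v)))"
proof
  fix p :: "idx \<times> idx"
  obtain I J where p: "p = (I, J)" by (cases p)
  have form: "mult_form I J x y z w
      = L (\<lambda>i. koszul s (idx_parity i) * (M (ucoords w) J * ucoords z i)) I"
    if z: "z \<in> carrier (Uq q)" and w: "w \<in> carrier (Uq q)" for z w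
  proof -
    have split: "(\<lambda>i. koszul s (idx_parity i) * (M (ucoords w) J * ucoords z i))
        = (\<lambda>i. (M (ucoords w) J * koszul s 0) * ucoords (hpart (Uq q) 0 z) i
            + (M (ucoords w) J * koszul s 1) * ucoords (hpart (Uq q) 1 z) i)"
    proof
      fix i
      show "koszul s (idx_parity i) * (M (ucoords w) J * ucoords z i)
        = (M (ucoords w) J * koszul s 0) * ucoords (hpart (Uq q) 0 z) i
            + (M (ucoords w) J * koszul s 1) * ucoords (hpart (Uq q) 1 z) i"
        by (cases "idx_parity i") (use z in \<open>simp_all add: ucoords_hpart\<close>)
    qed
    have "mult_form I J x y z w = (\<Sum>j\<in>{0, 1}. koszul s j *
        (ucoords (x \<otimes>\<^bsub>Uq q\<^esub> hpart (Uq q) j z) I * ucoords (y \<otimes>\<^bsub>Uq q\<^esub> w) J))"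
      unfolding mult_form_def sum.cartesian_product[symmetric]
      by (cases s) (use x y z w in \<open>simp_all add: hp\<close>)
    also have "\<dots> = L (\<lambda>i. (M (ucoords w) J * koszul s 0) * ucoords (hpart (Uq q) 0 z) i
            + (M (ucoords w) J * koszul s 1) * ucoords (hpart (Uq q) 1 z) i) I"
      unfolding lin_op_add[OF lin(1)] lin_op_scale[OF lin(1)]
      using x y z w by simp
    finally show ?thesis by (simp only: split)
  qed
  have "tcoords (Poly_Mapping.single (x, y) 1 \<otimes>\<^bsub>UV\<^esub> v) p
      = lext (\<lambda>k. L (\<lambda>i. koszul s (idx_parity i) * (M (ucoords (snd k)) J * ucoords (fst k) i)) I) v"
    unfolding p tcoords_mult lext_single
    by (simp, rule lext_cong) (use v in \<open>auto simp: form\<close>)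
  \<comment> \<open>Linearity lets the finite sum over pairs pass inside \<open>L\<close>, and then
    inside \<open>M\<close>, until it becomes \<open>tcoords v\<close>.\<close>
  also have "\<dots> = L (\<lambda>i. lext (\<lambda>k. koszul s (idx_parity i) * (M (ucoords (snd k)) J * ucoords (fst k) i)) v) I"
    by (rule lin_op_lext[OF lin(1), symmetric])
  also have "\<dots> = L (\<lambda>i. lext (\<lambda>k. M (\<lambda>j. (koszul s (idx_parity i) * ucoords (fst k) i) * ucoords (snd k) j) J) v) I"
    unfolding lin_op_scale[OF lin(2)] by (simp only: mult_ac)
  also have "\<dots> = L (\<lambda>i. M (\<lambda>j. lext (\<lambda>k. (koszul s (idx_parity i) * ucoords (fst k) i) * ucoords (snd k) j) v) J) I"
    unfolding lin_op_lext[OF lin(2), symmetric] ..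
  also have "\<dots> = on1 L (on2 M (twist s (tcoords v))) p"
    by (simp add: p on1_def on2_def twist_def tcoords_def case_prod_unfold mult.assoc lext_scale)
  finally show "tcoords (Poly_Mapping.single (x, y) 1 \<otimes>\<^bsub>UV\<^esub> v) p = on1 L (on2 M (twist s (tcoords v))) p" .
qed

end

text \<open>The Gaussian binomial coefficient \<open>[n + m choose n]\<close> at \<open>r\<close>.\<close>

fun gauss :: "complex \<Rightarrow> nat \<Rightarrow> nat \<Rightarrow> complex" where
  "gauss r 0 m = 1"
| "gauss r (Suc n) 0 = 1"
| "gauss r (Suc n) (Suc m) = gauss r n (Suc m) + r ^ Suc n * gauss r (Suc n) m"

text \<open>
  \<open>\<Delta>(e\<^sup>b k\<^sup>a f\<^sup>c)\<close> is the sum over \<open>b = b1 + b2\<close>, \<open>c = c1 + c2\<close> of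
  \<open>split_coeff q b1 c1 b2 c2\<close> times \<open>e\<^bsup>b1\<^esup> k\<^bsup>a+b2\<^esup> f\<^bsup>c1\<^esup> \<otimes> e\<^bsup>b2\<^esup> k\<^bsup>a-c1\<^esup> f\<^bsup>c2\<^esup>\<close>. In particular every pair of basis vectors
  occurs in the coproduct of at most one basis vector.
\<close>

definition split_coeff :: "complex \<Rightarrow> nat \<Rightarrow> nat \<Rightarrow> nat \<Rightarrow> nat \<Rightarrow> complex" where
  "split_coeff q b1 c1 b2 c2 = (-1) ^ (c1 * b2) * gauss (- q) b1 b2 * gauss (- inverse q) c1 c2"

text \<open>The exponents of k in the two factors are a + b2 and a - c1; the condition says that
  both yield the same a.\<close>

fun comult_coords :: "complex \<Rightarrow> (idx \<Rightarrow> complex) \<Rightarrow> idx \<times> idx \<Rightarrow> complex" where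
  "comult_coords q v ((b1, a1, c1), (b2, a2, c2)) =
    (if a1 - int b2 = a2 + int c1
     then split_coeff q b1 c1 b2 c2 * v (b1 + b2, a1 - int b2, c1 + c2) else 0)"

lemma gauss_0_right [simp]: "gauss r n 0 = 1"
  by (cases n) simp_all

lemma koszul_of_nat: "koszul 1 (of_nat n) = (- 1) ^ n"
  by (cases "even n") (auto simp: koszul_def elim!: evenE oddE)

text \<open>Each equation multiplies the coproduct of a basis vector by that of one letter. For f
  and e the two summands of \<Delta> give the two terms of the Pascal rule for \<open>gauss\<close>;
  k only shifts exponents.\<close>

lemma act2_comult_coords:
  assumes "q \<noteq> 0"
  shows "act2 q Gf (comult_coords q (delta (0, 0, c))) = comult_coords q (delta (0, 0, Suc c))"
    "act2 q Gk (comult_coords q (delta (0, a, c))) = comult_coords q (delta (0, a + 1, c))"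
    "act2 q Gk' (comult_coords q (delta (0, a, c))) = comult_coords q (delta (0, a - 1, c))"
    "act2 q Ge (comult_coords q (delta (b, a, c))) = comult_coords q (delta (Suc b, a, c))"
proof -
  show "act2 q Gf (comult_coords q (delta (0, 0, c))) = comult_coords q (delta (0, 0, Suc c))"
  proof (rule ext, clarify)
    fix b1 a1 c1 b2 a2 c2
    show "act2 q Gf (comult_coords q (delta (0, 0, c))) ((b1, a1, c1), (b2, a2, c2))
      = comult_coords q (delta (0, 0, Suc c)) ((b1, a1, c1), (b2, a2, c2))"
    proof (cases "b1 = 0 \<and> b2 = 0 \<and> a1 = 0 \<and> a2 = - int c1 \<and> c1 + c2 = Suc c")
      case True
      \<comment> \<open>The factor q^a2 of \<open>act\<close> with a2 = -c1 and the sign (-1)^c1 of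
        \<open>twist\<close> combine to the weight in the Pascal rule.\<close>
      have sign: "(- inverse q) ^ c1 = q powi (- int c1) * (- 1) ^ c1"
        by (simp add: power_int_minus power_inverse power_minus[of "inverse q"])
      have "on1 (act q Gf) (on2 (act q Gk') (comult_coords q (delta (0, 0, c)))) ((b1, a1, c1), (b2, a2, c2))
        = (case c1 of 0 \<Rightarrow> 0 | Suc d \<Rightarrow> gauss (- inverse q) d c2)"
        using True by (cases c1) (simp_all add: on1_def on2_def delta_def split_coeff_def)
      moreover have "on2 (act q Gf) (twist 1 (comult_coords q (delta (0, 0, c)))) ((b1, a1, c1), (b2, a2, c2))
        = (case c2 of 0 \<Rightarrow> 0 | Suc e \<Rightarrow> (- inverse q) ^ c1 * gauss (- inverse q) c1 e)"
        using True
        by (cases c2) (simp_all add: on2_def twist_def koszul_of_nat delta_def split_coeff_def sign)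
      ultimately show ?thesis
        using True by (cases c1; cases c2) (simp_all add: delta_def split_coeff_def)
    next
      case False
      then show ?thesis
        by (cases c1; cases c2) (auto simp: on1_def on2_def twist_def delta_def)
    qed
  qed
  show "act2 q Gk (comult_coords q (delta (0, a, c))) = comult_coords q (delta (0, a + 1, c))"
    "act2 q Gk' (comult_coords q (delta (0, a, c))) = comult_coords q (delta (0, a - 1, c))"
    by (rule ext, clarify, auto simp: on1_def on2_def delta_def split_coeff_def)+
  show "act2 q Ge (comult_coords q (delta (b, a, c))) = comult_coords q (delta (Suc b, a, c))"
  proof (rule ext, clarify)
    fix b1 a1 c1 b2 a2 c2
    show "act2 q Ge (comult_coords q (delta (b, a, c))) ((b1, a1, c1), (b2, a2, c2))
      = comult_coords q (delta (Suc b, a, c)) ((b1, a1, c1), (b2, a2, c2))"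
    proof (cases "b1 + b2 = Suc b \<and> c1 + c2 = c \<and> a1 = a + int b2 \<and> a2 = a - int c1")
      case True
      have "on1 (act q Ge) (comult_coords q (delta (b, a, c))) ((b1, a1, c1), (b2, a2, c2))
        = (case b1 of 0 \<Rightarrow> 0 | Suc d \<Rightarrow> split_coeff q d c1 b2 c2)"
        using True by (cases b1) (simp_all add: on1_def delta_def)
      \<comment> \<open>Here k contributes q^b1 and \<open>twist\<close> contributes (-1)^(b1 + c1).
        The part (-1)^c1 raises (-1)^(c1 e) to (-1)^(c1 b2), and (-q)^b1 is the Pascal
        weight.\<close>
      moreover have "on1 (act q Gk) (on2 (act q Ge) (twist 1 (comult_coords q (delta (b, a, c)))))
          ((b1, a1, c1), (b2, a2, c2))
        = (case b2 of 0 \<Rightarrow> 0 | Suc e \<Rightarrow> q ^ b1 * ((- 1) ^ (b1 + c1) * split_coeff q b1 c1 e c2))"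
        using True koszul_of_nat[of "b1 + c1"]
        by (cases b2) (simp_all add: on1_def on2_def twist_def delta_def)
      ultimately have "act2 q Ge (comult_coords q (delta (b, a, c))) ((b1, a1, c1), (b2, a2, c2))
        = (case b1 of 0 \<Rightarrow> 0 | Suc d \<Rightarrow> split_coeff q d c1 b2 c2)
          + (case b2 of 0 \<Rightarrow> 0 | Suc e \<Rightarrow> q ^ b1 * ((- 1) ^ (b1 + c1) * split_coeff q b1 c1 e c2))"
        by (simp only: act2.simps)
      also have "\<dots> = split_coeff q b1 c1 b2 c2"
        using True
        by (cases b1; cases b2)
          (auto simp add: split_coeff_def power_add power_minus[of q] algebra_simps)
      also have "\<dots> = comult_coords q (delta (Suc b, a, c)) ((b1, a1, c1), (b2, a2, c2))"
        using True by (simp add: delta_def)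
      finally show ?thesis .
    next
      case False
      then show ?thesis
        by (cases b1; cases b2) (auto simp: on1_def on2_def twist_def delta_def)
    qed
  qed
qed

section \<open>The coproduct of a class\<close>

context osp
begin

abbreviation "umap \<equiv> qmap tcoords"

lemma utensor_coset: "utensor q x y = UU.coset (Poly_Mapping.single (x, y) 1)"
  by (simp add: pure_tensor_def)

lemma single_carrier: "x \<in> carrier (Uq q) \<Longrightarrow> y \<in> carrier (Uq q) \<Longrightarrow> Poly_Mapping.single (x, y) c \<in> carrier UV"
  by (simp add: lookup_keys_subset lookup_single when_def)

lemma utensor_carrier [simp]:
  "x \<in> carrier (Uq q) \<Longrightarrow> y \<in> carrier (Uq q) \<Longrightarrow> utensor q x y \<in> carrier (UU q)"
  unfolding utensor_coset by (rule UU.coset_carrier) (rule single_carrier)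

lemma umap_utensor:
  assumes "x \<in> carrier (Uq q)" "y \<in> carrier (Uq q)"
  shows "umap (utensor q x y) (i, j) = ucoords x i * ucoords y j"
  using UU.qmap_coset[OF single_carrier[OF assms]] by (simp add: utensor_coset tcoords_single)

lemma ugen_carrier [simp]: "ugen q g \<in> carrier (Uq q)"
  by (simp add: ugen_cls)

lemma hpart_ugen: "hpart (Uq q) i (ugen q g) = (if i = gen_parity g then ugen q g else \<zero>\<^bsub>Uq q\<^esub>)"
proof -
  have "act q g (delta (0, 0, 0)) k = 0" if "idx_parity k \<noteq> gen_parity g" for k
  proof (rule ccontr)
    assume nz: "act q g (delta (0, 0, 0)) k \<noteq> 0"
    have "idx_parity k = gen_parity g + 0"
      by (rule act_parity[OF _ nz]) (auto simp: delta_def split: if_splits)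
    with that show False by (metis add_0_right)
  qed
  then have "ucoords (hpart (Uq q) i (ugen q g)) k
      = ucoords (if i = gen_parity g then ugen q g else \<zero>\<^bsub>Uq q\<^esub>) k" for k
    by (auto simp: ucoords_hpart ugen_cls coords_def simp del: act.simps)
  then show ?thesis by (subst U.qmap_inj) auto
qed

lemma hpart_one: "hpart (Uq q) i \<one>\<^bsub>Uq q\<^esub> = (if i = 0 then \<one>\<^bsub>Uq q\<^esub> else \<zero>\<^bsub>Uq q\<^esub>)"
  by (subst U.qmap_inj) (auto simp: ucoords_hpart cls_one coords_def delta_def)

lemma lin_op_id: "lin_op (\<lambda>v. v)"
  by (simp add: lin_op_def)

lemma tcoords_mult_add:
  "tcoords ((u + u') \<otimes>\<^bsub>UV\<^esub> v) p = tcoords (u \<otimes>\<^bsub>UV\<^esub> v) p + tcoords (u' \<otimes>\<^bsub>UV\<^esub> v) p"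
  by (cases p) (simp only: tcoords_mult lext_add)

text \<open>\<open>free_lift\<close> builds the image of a word by left multiplications starting
  from the unit, so left multiplication by the coproducts of generators determines
  \<open>comult\<close>.\<close>

lemma comult_gen_mult:
  assumes "X \<in> carrier (UU q)"
  shows "comult_gen q g \<otimes>\<^bsub>UU q\<^esub> X \<in> carrier (UU q)"
    and "umap (comult_gen q g \<otimes>\<^bsub>UU q\<^esub> X) = act2 q g (umap X)"
proof -
  from assms obtain v where v: "v \<in> carrier UV" "X = UU.coset v"
    by (rule UU.carrier_QE)
  have single: "tcoords (Poly_Mapping.single (x, y) 1 \<otimes>\<^bsub>UV\<^esub> v) = on1 L (on2 M (twist s (tcoords v)))"
    if "x = ugen q g \<and> L = act q g \<or> x = \<one>\<^bsub>Uq q\<^esub> \<and> L = (\<lambda>v. v)"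
      "y = ugen q h \<and> M = act q h \<and> s = gen_parity h \<or> y = \<one>\<^bsub>Uq q\<^esub> \<and> M = (\<lambda>v. v) \<and> s = 0"
    for x y g h L M s
    by (rule tcoords_single_mult[OF _ _ _ _ _ _ _ v(1)])
      (use that in \<open>auto simp: ucoords_gen_mult hpart_ugen hpart_one lin_op_id simp del: act.simps\<close>)
  have twist_0: "twist 0 u = u" for u :: "idx \<times> idx \<Rightarrow> complex"
    by (auto simp: twist_def koszul_def)
  have id: "on1 (\<lambda>v. v) u = u" "on2 (\<lambda>v. v) u = u" for u :: "idx \<times> idx \<Rightarrow> complex"
    by (auto simp: on1_def on2_def)
  have "\<exists>d\<in>carrier UV. comult_gen q g = UU.coset d \<and> tcoords (d \<otimes>\<^bsub>UV\<^esub> v) = act2 q g (tcoords v)"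
  proof (cases g)
    case Gk
    show ?thesis
      by (rule bexI[OF _ single_carrier[of "ugen q Gk" "ugen q Gk"]])
        (auto simp: Gk utensor_coset single[of "ugen q Gk" Gk "act q Gk" "ugen q Gk" Gk "act q Gk" 0] twist_0 fun_eq_iff simp del: act.simps)
  next
    case Gk'
    show ?thesis
      by (rule bexI[OF _ single_carrier[of "ugen q Gk'" "ugen q Gk'"]])
        (auto simp: Gk' utensor_coset single[of "ugen q Gk'" Gk' "act q Gk'" "ugen q Gk'" Gk' "act q Gk'" 0] twist_0 fun_eq_iff simp del: act.simps)
  next
    case Ge
    have "comult_gen q Ge = UU.coset (Poly_Mapping.single (ugen q Ge, \<one>\<^bsub>Uq q\<^esub>) 1
        + Poly_Mapping.single (ugen q Gk, ugen q Ge) 1)"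
      by (simp add: utensor_coset UU.coset_add single_carrier del: pretensor_simps)
    moreover have "tcoords ((Poly_Mapping.single (ugen q Ge, \<one>\<^bsub>Uq q\<^esub>) 1
        + Poly_Mapping.single (ugen q Gk, ugen q Ge) 1) \<otimes>\<^bsub>UV\<^esub> v) = act2 q Ge (tcoords v)"
      by (rule ext) (simp add: tcoords_mult_add single[of _ Ge "act q Ge" _ _ "\<lambda>v. v" 0]
        single[of _ Gk "act q Gk" _ Ge "act q Ge" 1] twist_0 id del: act.simps)
    ultimately show ?thesis
      unfolding Ge by (intro bexI[OF _ UU.add_closed] conjI single_carrier) auto
  next
    case Gf
    have "comult_gen q Gf = UU.coset (Poly_Mapping.single (ugen q Gf, ugen q Gk') 1
        + Poly_Mapping.single (\<one>\<^bsub>Uq q\<^esub>, ugen q Gf) 1)"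
      by (simp add: utensor_coset UU.coset_add single_carrier del: pretensor_simps)
    moreover have "tcoords ((Poly_Mapping.single (ugen q Gf, ugen q Gk') 1
        + Poly_Mapping.single (\<one>\<^bsub>Uq q\<^esub>, ugen q Gf) 1) \<otimes>\<^bsub>UV\<^esub> v) = act2 q Gf (tcoords v)"
      by (rule ext) (simp add: tcoords_mult_add single[of _ Gf "act q Gf" _ Gk' "act q Gk'" 0]
        single[of _ _ "\<lambda>v. v" _ Gf "act q Gf" 1] twist_0 id del: act.simps)
    ultimately show ?thesis
      unfolding Gf by (intro bexI[OF _ UU.add_closed] conjI single_carrier) auto
  qed
  then obtain d where d: "d \<in> carrier UV" "comult_gen q g = UU.coset d"
    "tcoords (d \<otimes>\<^bsub>UV\<^esub> v) = act2 q g (tcoords v)" by blast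
  have eq: "comult_gen q g \<otimes>\<^bsub>UU q\<^esub> X = UU.coset (d \<otimes>\<^bsub>UV\<^esub> v)"
    using UU_mult[OF d(1) v(1)] by (simp add: v(2) d(2))
  show "comult_gen q g \<otimes>\<^bsub>UU q\<^esub> X \<in> carrier (UU q)"
    unfolding eq by (rule UU.coset_carrier[OF UV_mult_closed[OF d(1) v(1)]])
  show "umap (comult_gen q g \<otimes>\<^bsub>UU q\<^esub> X) = act2 q g (umap X)"
    unfolding eq unfolding v(2) UU.qmap_coset[OF UV_mult_closed[OF d(1) v(1)]] UU.qmap_coset[OF v(1)]
    by (rule d(3))
qed

abbreviation "one2 \<equiv> delta ((0, 0, 0), (0, 0, 0)) :: idx \<times> idx \<Rightarrow> complex"

lemma UU_one: "\<one>\<^bsub>UU q\<^esub> = utensor q \<one>\<^bsub>Uq q\<^esub> \<one>\<^bsub>Uq q\<^esub>"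
  by (simp add: tensor_superalg_def quot_superalg_def pure_tensor_def)

lemma umap_one: "umap \<one>\<^bsub>UU q\<^esub> = one2"
proof
  fix p :: "idx \<times> idx"
  show "umap \<one>\<^bsub>UU q\<^esub> p = one2 p"
    by (cases p) (simp add: UU_one umap_utensor, simp add: cls_one coords_def delta_def)
qed

lemma comult_word:
  "foldr (\<lambda>g t. comult_gen q g \<otimes>\<^bsub>UU q\<^esub> t) ws \<one>\<^bsub>UU q\<^esub> \<in> carrier (UU q) \<and>
   umap (foldr (\<lambda>g t. comult_gen q g \<otimes>\<^bsub>UU q\<^esub> t) ws \<one>\<^bsub>UU q\<^esub>) = foldr (act2 q) ws one2"
  by (induction ws) (simp_all add: umap_one comult_gen_mult, simp add: UU_one)

lemma free_lift_comult:
  "free_lift (UU q) (comult_gen q) a \<in> carrier (UU q)"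
  "umap (free_lift (UU q) (comult_gen q) a) p = rep (act2 q) a one2 p"
  unfolding free_lift_def
  by (simp_all add: UU.Q.finsum_closed UU.qmap_finsum UU.qmap_smult comult_word rep_def lext_def Pi_def)

lemma comult_cls: "comult q (cls a) = free_lift (UU q) (comult_gen q) a"
proof -
  have "free_lift (UU q) (comult_gen q) b = free_lift (UU q) (comult_gen q) a"
    if "coords q b = coords q a" for b
  proof -
    have "rep (act2 q) b = rep (act2 q) a"
      by (rule rep_cong[OF _ _ that]) (simp_all add: rep_act2_rels[OF q_nz])
    then show ?thesis
      by (subst UU.qmap_inj) (simp_all add: free_lift_comult)
  qed
  note const = this
  show ?thesis
    unfolding comult_def qmap_def[symmetric] by (rule U.qmap_coset_const, simp, rule const)
qed

text \<open>Both sides are linear in \<open>a\<close> and vanish on the ideal, so PBW vectors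
  suffice; there \<open>foldr_pbw_word\<close> carries the coproduct along the word.\<close>

lemma rep_act2_one2: "rep (act2 q) a one2 p = comult_coords q (coords q a) p"
proof -
  obtain b1 a1 c1 b2 a2 c2 where p: "p = ((b1, a1, c1), (b2, a2, c2))"
    by (metis prod.collapse)
  have one2: "comult_coords q (delta (0, 0, 0)) = one2"
    by (rule ext) (auto simp: delta_def split_coeff_def split: if_splits)
  from pbw_spanned[OF q_nz] show ?thesis
  proof (rule pm.span_induct)
    show "pm.subspace {a. rep (act2 q) a one2 p = comult_coords q (coords q a) p}"
      by (auto simp: pm.subspace_def p rep_add rep_pscale coords_add coords_pscale algebra_simps
        coords_ideal[OF q_nz osp_ideal_0])
  next
    fix a assume "a \<in> range (\<lambda>i. wmon (pbw_word i)) \<union> osp_ideal q"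
    then show "rep (act2 q) a one2 p = comult_coords q (coords q a) p"
    proof
      assume "a \<in> range (\<lambda>i. wmon (pbw_word i))"
      then obtain i where i: "a = wmon (pbw_word i)" by blast
      have "foldr (act2 q) (pbw_word i) (comult_coords q (delta (0, 0, 0))) = comult_coords q (delta i)"
        by (rule foldr_pbw_word) (simp_all only: act2_comult_coords[OF q_nz])
      then have "rep (act2 q) a one2 p = comult_coords q (delta i) p"
        by (simp only: i one2 wmon_def rep_single word.sel mult_1)
      then show ?thesis by (simp only: i coords_pbw)
    next
      assume a: "a \<in> osp_ideal q"
      have "rep (act2 q) a one2 p = 0"
        by (rule rep_osp_ideal[OF _ _ a]) (simp_all add: rep_act2_rels[OF q_nz])
      then show ?thesis
        by (simp add: p coords_ideal[OF q_nz a])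
    qed
  qed
qed

lemma comult_closed: "X \<in> carrier (Uq q) \<Longrightarrow> comult q X \<in> carrier (UU q)"
  by (auto elim!: carrier_clsE simp: comult_cls free_lift_comult)

lemma umap_comult: "X \<in> carrier (Uq q) \<Longrightarrow> umap (comult q X) p = comult_coords q (ucoords X) p"
  by (auto elim!: carrier_clsE simp: comult_cls free_lift_comult rep_act2_one2)

end

section \<open>Group-like and skew-primitive coordinate functions\<close>

text \<open>\<open>gauss r 1 m\<close> is the geometric sum 1 + r + ... + r^m, and 1 - r times it is
  1 - r^(m+1).\<close>

lemma gauss_1_nonzero:
  assumes "\<And>n. n > 0 \<Longrightarrow> r ^ n \<noteq> 1"
  shows "gauss r 1 m \<noteq> 0"
proof -
  have "(1 - r) * gauss r (Suc 0) m = 1 - r ^ Suc m" for m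
  proof (induction m)
    case (Suc m)
    have "(1 - r) * gauss r (Suc 0) (Suc m) = 1 - r + r * ((1 - r) * gauss r (Suc 0) m)"
      by (simp add: algebra_simps)
    also have "\<dots> = 1 - r ^ Suc (Suc m)"
      unfolding Suc.IH by (simp add: algebra_simps)
    finally show ?case .
  qed simp
  then have "(1 - r) * gauss r 1 m = 1 - r ^ Suc m" for m by simp
  with assms[of "Suc m"] show ?thesis
    by (metis diff_eq_diff_eq diff_self mult_zero_right eq_iff_diff_eq_0 zero_less_Suc)
qed

text \<open>The coordinates of \<alpha> e k^m + \<beta> k^n f + \<gamma> (k^m - k^n). Each of e k^m
  and k^n f is (k^m, k^n)-primitive precisely when n = m + 1.\<close>

definition skew_vec :: "int \<Rightarrow> int \<Rightarrow> complex \<Rightarrow> complex \<Rightarrow> complex \<Rightarrow> idx \<Rightarrow> complex" where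
  "skew_vec m n \<alpha> \<beta> \<gamma> = (\<lambda>i. \<alpha> * delta (1, m, 0) i + \<beta> * delta (0, n, 1) i
     + \<gamma> * (delta (0, m, 0) i - delta (0, n, 0) i))"

lemma comult_coords_linear:
  "comult_coords q (\<lambda>i. u i + v i) p = comult_coords q u p + comult_coords q v p"
  "comult_coords q (\<lambda>i. u i - v i) p = comult_coords q u p - comult_coords q v p"
  "comult_coords q (\<lambda>i. c * v i) p = c * comult_coords q v p"
proof -
  obtain b1 a1 c1 b2 a2 c2 where p: "p = ((b1, a1, c1), (b2, a2, c2))"
    by (metis prod.collapse)
  show "comult_coords q (\<lambda>i. u i + v i) p = comult_coords q u p + comult_coords q v p"
    "comult_coords q (\<lambda>i. u i - v i) p = comult_coords q u p - comult_coords q v p"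
    "comult_coords q (\<lambda>i. c * v i) p = c * comult_coords q v p"
    by (simp_all add: p algebra_simps)
qed

lemma comult_coords_delta:
  "comult_coords q (delta (0, m, 0)) (i, j) = delta (0, m, 0) i * delta (0, m, 0) j"
  "comult_coords q (delta (1, m, 0)) (i, j)
    = delta (1, m, 0) i * delta (0, m, 0) j + delta (0, m + 1, 0) i * delta (1, m, 0) j"
  "comult_coords q (delta (0, n, 1)) (i, j)
    = delta (0, n, 1) i * delta (0, n - 1, 0) j + delta (0, n, 0) i * delta (0, n, 1) j"
  by (cases i; cases j; auto simp: delta_def split_coeff_def add_is_1)+

lemma comult_coords_skew_vec:
  assumes "n \<noteq> m + 1 \<longrightarrow> \<alpha> = 0 \<and> \<beta> = 0"
  shows "comult_coords q (skew_vec m n \<alpha> \<beta> \<gamma>) (i, j)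
    = skew_vec m n \<alpha> \<beta> \<gamma> i * delta (0, m, 0) j + delta (0, n, 0) i * skew_vec m n \<alpha> \<beta> \<gamma> j"
  using assms
  by (cases "n = m + 1")
    (simp_all add: skew_vec_def comult_coords_linear comult_coords_delta del: One_nat_def,
      simp_all add: algebra_simps)

text \<open>Each claim evaluates the primitivity equation at pairs of basis vectors chosen so that
  at most one or two coefficients of \<open>v\<close> remain.\<close>

lemma skew_vec_classification:
  assumes q: "q \<noteq> 0" "\<And>n. n > 0 \<Longrightarrow> q ^ n \<noteq> 1"
    and v: "\<And>i j. comult_coords q v (i, j) = v i * delta (0, m, 0) j + delta (0, n, 0) i * v j"
  shows "\<exists>\<alpha> \<beta> \<gamma>. v = skew_vec m n \<alpha> \<beta> \<gamma> \<and> (n \<noteq> m + 1 \<longrightarrow> \<alpha> = 0 \<and> \<beta> = 0)"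
proof -
  \<comment> \<open>Squaring removes the sign: (-q)^k = 1 would give q^(2k) = 1.\<close>
  have sq: "(- q) ^ k \<noteq> 1" "(- inverse q) ^ k \<noteq> 1" if "k > 0" for k
  proof -
    have "(- q) ^ k \<noteq> 1 \<and> (- inverse q) ^ k \<noteq> 1"
    proof (rule ccontr)
      assume "\<not> ?thesis"
      then have "((- q) ^ k) ^ 2 = 1 \<or> ((- inverse q) ^ k) ^ 2 = 1"
        by auto
      moreover have "((- q) ^ k) ^ 2 = q ^ (2 * k)"
        by (metis power_mult power2_minus mult.commute)
      moreover have "((- inverse q) ^ k) ^ 2 = inverse (q ^ (2 * k))"
        by (metis power_mult power2_minus mult.commute power_inverse)
      ultimately have "q ^ (2 * k) = 1" by auto
      with q(2)[of "2 * k"] that show False by simp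
    qed
    then show "(- q) ^ k \<noteq> 1" "(- inverse q) ^ k \<noteq> 1" by auto
  qed
  \<comment> \<open>The pair e k^(a+b), e^b k^a f^c occurs only in \<Delta>(e^(b+1) k^a f^c), with
    weight \<open>gauss (- q) 1 b\<close>. Its left entry is not k^n and its right entry is not k^m,
    so the right side vanishes.\<close>
  have e: "v (Suc b, a, c) = 0" if "b + c \<ge> 1" for b a c
    using v[of "(1, a + int b, 0)" "(b, a, c)"] that gauss_1_nonzero[OF sq(1), of b]
    by (auto simp: delta_def split_coeff_def split: if_splits)
  \<comment> \<open>The same with one f split off to the left: the pair k^a f, k^(a-1) f^c has
    weight \<open>gauss (- inverse q) 1 c\<close>.\<close>
  have f: "v (0, a, Suc c) = 0" if "c \<ge> 1" for a c
    using v[of "(0, a, 1)" "(0, a - 1, c)"] that gauss_1_nonzero[OF sq(2), of c]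
    by (auto simp: delta_def split_coeff_def)
  \<comment> \<open>The summand e k^a \<otimes> k^a forces a = m, and k^(a+1) \<otimes> e k^a forces
    a + 1 = n.\<close>
  have e1: "v (1, a, 0) = 0" if "a \<noteq> m \<or> n \<noteq> m + 1" for a
    using v[of "(1, a, 0)" "(0, a, 0)"] v[of "(0, a + 1, 0)" "(1, a, 0)"] that
    by (auto simp: delta_def split_coeff_def split: if_splits)
  have f1: "v (0, a, 1) = 0" if "a \<noteq> n \<or> n \<noteq> m + 1" for a
    using v[of "(0, a, 1)" "(0, a - 1, 0)"] v[of "(0, a, 0)" "(0, a, 1)"] that
    by (auto simp: delta_def split_coeff_def split: if_splits)
  \<comment> \<open>On the diagonal the coefficient is counted once for a = m and once for a = n;
    for a = m = n it equals twice itself.\<close>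
  have k: "v (0, a, 0) = 0" if "a \<noteq> m \<and> a \<noteq> n \<or> m = n" for a
    using v[of "(0, a, 0)" "(0, a, 0)"] that
    by (auto simp: delta_def split_coeff_def split: if_splits)
  \<comment> \<open>For m \<noteq> n the pair k^n, k^m occurs in no coproduct, so the two terms on
    the right cancel.\<close>
  have k1: "v (0, n, 0) = - v (0, m, 0)"
    using v[of "(0, n, 0)" "(0, m, 0)"] k[of m]
    by (cases "m = n") (auto simp: delta_def split_coeff_def eq_neg_iff_add_eq_0 add.commute)
  have "v i = skew_vec m n (v (1, m, 0)) (v (0, n, 1)) (v (0, m, 0)) i" for i
  proof -
    obtain b a c where i: "i = (b, a, c)" by (cases i)
    consider "b + c \<ge> 2" | "b = 1" "c = 0" | "b = 0" "c = 1" | "b = 0" "c = 0" by linarith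
    then show ?thesis
    proof cases
      case 1
      then have "v i = 0"
        using e[of "b - 1" c a] f[of "c - 1" a] by (cases b; cases c) (auto simp: i)
      with 1 show ?thesis by (auto simp: i skew_vec_def delta_def)
    next
      case 4
      consider "m = n" | "a = m" "m \<noteq> n" | "a = n" "m \<noteq> n" | "a \<noteq> m" "a \<noteq> n" by blast
      then show ?thesis
      proof cases
        case 3
        with 4 k1 show ?thesis by (simp add: i skew_vec_def delta_def)
      qed (use 4 k[of a] in \<open>simp_all add: i skew_vec_def delta_def\<close>)
    qed (use e1[of a] f1[of a] in \<open>auto simp: i skew_vec_def delta_def\<close>)
  qed
  with e1[of m] f1[of n] show ?thesis by blast
qed

text \<open>The coefficients of the powers of k are orthogonal idempotents in the complex numbers,
  so at most one is nonzero, and it is 1.\<close>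

lemma grouplike_classification:
  assumes v: "\<And>i j. comult_coords q v (i, j) = v i * v j" and nz: "\<exists>i. v i \<noteq> 0"
  shows "\<exists>m. v = delta (0, m, 0)"
proof -
  \<comment> \<open>For b + c > 0 the pair (i, i) violates the condition on exponents, so the square
    of \<open>v i\<close> is 0.\<close>
  have ef: "v (b, a, c) = 0" if "b + c > 0" for b a c
    using v[of "(b, a, c)" "(b, a, c)"] that by (auto split: if_splits)
  have k: "v (0, a, 0) * v (0, a', 0) = (if a = a' then v (0, a, 0) else 0)" for a a'
    using v[of "(0, a, 0)" "(0, a', 0)"] by (auto simp: split_coeff_def)
  obtain b m c where "v (b, m, c) \<noteq> 0"
    using nz by (metis prod.collapse)
  with ef[of b c m] have m: "v (0, m, 0) \<noteq> 0" by (cases "b + c > 0") auto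
  then have "v (0, a, 0) = 0" if "a \<noteq> m" for a
    using k[of m a] that by auto
  with m k[of m m] have *: "v (0, m, 0) = 1" "\<And>a. a \<noteq> m \<Longrightarrow> v (0, a, 0) = 0"
    by auto
  have "v i = delta (0, m, 0) i" for i
  proof -
    obtain b a c where "i = (b, a, c)" by (cases i)
    with * ef[of b c a] show ?thesis by (cases "b + c > 0") (auto simp: delta_def)
  qed
  then show ?thesis by blast
qed


section \<open>Group-like and skew-primitive elements\<close>

lemma coords_kword: "coords q (wmon (kword m)) = delta (0, m, 0)"
  using coords_pbw[of q "(0, m, 0)"] by simp

lemma foldr_act_kword:
  assumes "q \<noteq> 0"
  shows "foldr (act q) (kword m) v (b, a, c) = (q powi m) ^ b * v (b, a - m, c)"
proof -
  \<comment> \<open>\<open>d s\<close> is k^s applied to an arbitrary \<open>v\<close>;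
    \<open>foldr_kword\<close> is used along this orbit instead of along basis vectors.\<close>
  define d where "d s = (\<lambda>(b, a, c). (q powi s) ^ b * v (b, a - s, c))" for s :: int
  have "d 0 = v" by (auto simp: d_def)
  moreover have "foldr (act q) (kword m) (d 0) = d m"
  proof (rule foldr_kword)
    show "act q Gk (d s) = d (s + 1)" for s
      by (rule ext, clarify)
        (simp add: d_def power_int_add assms power_mult_distrib diff_diff_eq add.commute)
    show "act q Gk' (d s) = d (s - 1)" for s
      by (rule ext, clarify)
        (simp add: d_def power_int_diff assms power_divide field_simps)
  qed
  ultimately show ?thesis by (simp add: d_def)
qed

context osp
begin

lemma kword_cls_mult: "cls (wmon (kword m)) \<otimes>\<^bsub>Uq q\<^esub> cls (wmon (kword n)) = cls (wmon (kword (m + n)))"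
proof -
  have "foldr (act q) (kword m) (delta (0, n, 0)) = delta (0, m + n, 0)"
    using foldr_kword[of "act q" "\<lambda>a. delta (0, a + n, 0)" m] by (simp add: act_delta algebra_simps)
  then show ?thesis
    unfolding cls_mult cls_eq_iff coords_mult coords_kword
    by (intro ext) (simp add: wmon_def rep_single)
qed

lemma kword_cls_0: "cls (wmon (kword 0)) = \<one>\<^bsub>Uq q\<^esub>"
  by (simp add: kword_def wmon_Nil cls_one)

lemma kpow_eq: "kpow q m = cls (wmon (kword m))"
proof -
  have nat: "ugen q Gk [^]\<^bsub>Uq q\<^esub> n = cls (wmon (kword (int n)))" for n :: nat
  proof (induction n)
    case (Suc n)
    have "ugen q Gk = cls (wmon (kword 1))"
      by (simp add: ugen_cls free_gen_eq_wmon kword_def)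
    with Suc show ?case by (simp add: kword_cls_mult add.commute)
  qed (simp add: kword_cls_0)
  show ?thesis
  proof (cases "m \<ge> 0")
    case True
    then show ?thesis
      using nat[of "nat m"] by (simp add: kpow_def int_pow_int[symmetric])
  next
    case False
    then have "kpow q m = inv\<^bsub>Uq q\<^esub> cls (wmon (kword (- m)))"
      using nat[of "nat (- m)"] by (simp add: kpow_def int_pow_def nat_pow_def)
    also have "\<dots> = cls (wmon (kword m))"
      by (rule U.inv_char) (simp_all add: kword_cls_mult kword_cls_0)
    finally show ?thesis .
  qed
qed

lemma kpow_carrier [simp]: "kpow q m \<in> carrier (Uq q)"
  by (simp add: kpow_eq)

lemma ucoords_kpow [simp]: "ucoords (kpow q m) = delta (0, m, 0)"
  by (simp add: kpow_eq coords_kword)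

lemma ucoords_kpow_mult:
  "X \<in> carrier (Uq q) \<Longrightarrow>
    ucoords (kpow q m \<otimes>\<^bsub>Uq q\<^esub> X) (b, a, c) = (q powi m) ^ b * ucoords X (b, a - m, c)"
  by (auto elim!: carrier_clsE simp: kpow_eq cls_mult coords_mult wmon_def rep_single
    foldr_act_kword[OF q_nz])

lemma kpow_mult: "kpow q m \<otimes>\<^bsub>Uq q\<^esub> kpow q n = kpow q (m + n)"
  by (simp add: kpow_eq kword_cls_mult)

lemma kpow_0: "kpow q 0 = \<one>\<^bsub>Uq q\<^esub>"
  by (simp add: kpow_eq kword_cls_0)

lemma prims_iff:
  "X \<in> prims q m n \<longleftrightarrow> X \<in> carrier (Uq q) \<and> (\<forall>i j. comult_coords q (ucoords X) (i, j)
     = ucoords X i * delta (0, m, 0) j + delta (0, n, 0) i * ucoords X j)"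
proof (cases "X \<in> carrier (Uq q)")
  case True
  have "umap (utensor q X (kpow q m) \<oplus>\<^bsub>UU q\<^esub> utensor q (kpow q n) X) (i, j)
    = ucoords X i * delta (0, m, 0) j + delta (0, n, 0) i * ucoords X j" for i j
    using True by (subst UU.qmap_add) (simp_all only: utensor_carrier kpow_carrier umap_utensor ucoords_kpow)
  moreover have "X \<in> prims q m n \<longleftrightarrow> comult q X
      = utensor q X (kpow q m) \<oplus>\<^bsub>UU q\<^esub> utensor q (kpow q n) X"
    using True by (simp add: prims_def skew_primitives_def)
  moreover have "utensor q X (kpow q m) \<oplus>\<^bsub>UU q\<^esub> utensor q (kpow q n) X \<in> carrier (UU q)"
    using True by (intro UU.Q.a_closed utensor_carrier) simp_all
  ultimately show ?thesis
    using True comult_closed[OF True] umap_comult[OF True] UU.qmap_inj by (simp only: split_paired_All) auto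
qed (simp add: prims_def skew_primitives_def)

text \<open>The counit is a one-dimensional representation, on functions of one point, so
  \<open>rep_cong\<close> gives its well-definedness. The value at 0 excludes 0 as a group-like
  element.\<close>

lemma counit_zero: "counit (cls 0) = 0"
  and counit_kpow: "counit (kpow q m) = 1"
proof -
  define cact :: "gen \<Rightarrow> (unit \<Rightarrow> complex) \<Rightarrow> unit \<Rightarrow> complex"
    where "cact g v = (\<lambda>u. counit_gen g * v u)" for g v
  have lin: "lin_op (cact g)" for g
    by (simp add: lin_op_def cact_def algebra_simps)
  have rels: "rep cact r v i = 0" if "r \<in> osp_rels q" for r v i
    using that q_nz lin
    by (auto simp: osp_rels_def Let_def rep_diff rep_add rep_mult rep_pscale cact_def)
  have eq: "(\<lambda>a. \<Sum>w\<in>Poly_Mapping.keys a. Poly_Mapping.lookup a w * prod_list (map counit_gen (letters w)))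
    = (\<lambda>a. rep cact a (\<lambda>_. 1) ())"
  proof -
    have "foldr cact ws (\<lambda>_. 1) u = prod_list (map counit_gen ws)" for ws u
      by (induction ws) (simp_all add: cact_def)
    then show ?thesis by (simp add: rep_def lext_def)
  qed
  have counit: "counit (cls a) = rep cact a (\<lambda>_. 1) ()" for a
    unfolding counit_def eq qmap_def[symmetric]
  proof (rule U.qmap_coset_const)
    fix b assume "coords q b = coords q a"
    then show "rep cact b (\<lambda>_. 1) () = rep cact a (\<lambda>_. 1) ()"
      using rep_cong[OF lin rels] by metis
  qed simp
  show "counit (cls 0) = 0" by (simp add: counit)
  have "foldr cact (replicate n g) (\<lambda>_. 1) = (\<lambda>_. 1)" if "g = Gk \<or> g = Gk'" for n g
    using that by (induction n) (auto simp: cact_def)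
  then show "counit (kpow q m) = 1"
    by (simp add: kpow_eq counit wmon_def rep_single kword_def)
qed

lemma grouplike_iff: "grouplike q g \<longleftrightarrow> g \<in> range (kpow q)"
proof
  assume g: "grouplike q g"
  then have c: "g \<in> carrier (Uq q)" by (simp add: grouplike_def)
  have "comult_coords q (ucoords g) (i, j) = ucoords g i * ucoords g j" for i j
    using g umap_comult[OF c, of "(i, j)"] umap_utensor[OF c c] by (simp add: grouplike_def)
  moreover have "\<exists>i. ucoords g i \<noteq> 0"
  proof (rule ccontr)
    assume "\<not> ?thesis"
    then have "g = cls 0"
      using c by (subst U.qmap_inj) (auto simp: coords_ideal[OF q_nz osp_ideal_0])
    with g show False by (simp add: grouplike_def counit_zero)
  qed
  ultimately obtain m where "ucoords g = delta (0, m, 0)"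
    using grouplike_classification by blast
  then have "g = kpow q m"
    using c by (subst U.qmap_inj) auto
  then show "g \<in> range (kpow q)" by blast
next
  assume "g \<in> range (kpow q)"
  then obtain m where m: "g = kpow q m" by blast
  have "comult q g = utensor q g g"
    unfolding UU.qmap_inj[OF comult_closed[OF kpow_carrier] utensor_carrier[OF kpow_carrier kpow_carrier]] m
    by (simp add: umap_comult umap_utensor comult_coords_delta split_paired_All del: comult_coords.simps)
  then show "grouplike q g" by (simp add: grouplike_def m counit_kpow)
qed

end

section \<open>Descriptions of the spaces of skew-primitives\<close>

context osp
begin

lemma prims_carrier: "X \<in> prims q m n \<Longrightarrow> X \<in> carrier (Uq q)"
  by (simp add: prims_iff)

lemma ucoords_eqI: "X \<in> carrier (Uq q) \<Longrightarrow> Y \<in> carrier (Uq q) \<Longrightarrow> ucoords X = ucoords Y \<Longrightarrow> X = Y"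
  by (simp add: U.qmap_inj)

lemma cline_eq: "X \<in> cline q Y \<longleftrightarrow> (\<exists>c. X = c \<odot>\<^bsub>Uq q\<^esub> Y)"
  by (auto simp: cline_def)

abbreviation "f_k \<equiv> ugen q Gf \<otimes>\<^bsub>Uq q\<^esub> ugen q Gk"
abbreviation "k_1 \<equiv> ugen q Gk \<ominus>\<^bsub>Uq q\<^esub> \<one>\<^bsub>Uq q\<^esub>"

text \<open>The factor q comes from f k = q k f, and the sign from \<open>skew_vec\<close> counting
  k^m - k^n, here 1 - k.\<close>

lemma ucoords_linear_combination:
  "ucoords (a \<odot>\<^bsub>Uq q\<^esub> ugen q Ge \<oplus>\<^bsub>Uq q\<^esub> b \<odot>\<^bsub>Uq q\<^esub> f_k \<oplus>\<^bsub>Uq q\<^esub> c \<odot>\<^bsub>Uq q\<^esub> k_1)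
    = skew_vec 0 1 a (q * b) (- c)"
proof
  fix i
  have "ucoords (ugen q Ge) = delta (1, 0, 0)" "ucoords (ugen q Gk) = delta (0, 1, 0)"
    "ucoords \<one>\<^bsub>Uq q\<^esub> = delta (0, 0, 0)"
    by (auto simp: ugen_cls cls_one coords_def act_delta)
  moreover from this have "ucoords f_k = (\<lambda>i. q * delta (0, 1, 1) i)"
    by (simp add: ucoords_gen_mult act_delta)
  ultimately show "ucoords (a \<odot>\<^bsub>Uq q\<^esub> ugen q Ge \<oplus>\<^bsub>Uq q\<^esub> b \<odot>\<^bsub>Uq q\<^esub> f_k \<oplus>\<^bsub>Uq q\<^esub> c \<odot>\<^bsub>Uq q\<^esub> k_1) i
    = skew_vec 0 1 a (q * b) (- c) i"
    by (simp add: U.qmap_add U.qmap_smult U.qmap_diff skew_vec_def algebra_simps)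
qed

lemma linear_independence:
  assumes "a \<odot>\<^bsub>Uq q\<^esub> ugen q Ge \<oplus>\<^bsub>Uq q\<^esub> b \<odot>\<^bsub>Uq q\<^esub> f_k \<oplus>\<^bsub>Uq q\<^esub> c \<odot>\<^bsub>Uq q\<^esub> k_1 = \<zero>\<^bsub>Uq q\<^esub>"
  shows "a = 0 \<and> b = 0 \<and> c = 0"
proof -
  have "skew_vec 0 1 a (q * b) (- c) i = 0" for i
    using arg_cong[OF assms, of "\<lambda>X. ucoords X i"] by (simp add: ucoords_linear_combination)
  from this[of "(1, 0, 0)"] this[of "(0, 1, 1)"] this[of "(0, 0, 0)"] show ?thesis
    using q_nz by (simp add: skew_vec_def delta_def)
qed

text \<open>Multiplication by k^s shifts m and n and rescales the e-part, since k^s e = q^s e k^s;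
  the result is again a \<open>skew_vec\<close>.\<close>

lemma prims_shift:
  assumes q: "\<And>n. n > 0 \<Longrightarrow> q ^ n \<noteq> 1" and X: "X \<in> prims q m n"
  shows "kpow q s \<otimes>\<^bsub>Uq q\<^esub> X \<in> prims q (m + s) (n + s)"
proof -
  from X have c: "X \<in> carrier (Uq q)" by (rule prims_carrier)
  from X obtain \<alpha> \<beta> \<gamma> where v: "ucoords X = skew_vec m n \<alpha> \<beta> \<gamma>" "n \<noteq> m + 1 \<longrightarrow> \<alpha> = 0 \<and> \<beta> = 0"
    using skew_vec_classification[OF q_nz q] unfolding prims_iff by meson
  have "ucoords (kpow q s \<otimes>\<^bsub>Uq q\<^esub> X) = skew_vec (m + s) (n + s) (q powi s * \<alpha>) \<beta> \<gamma>"
    by (rule ext, clarify) (auto simp: ucoords_kpow_mult[OF c] v(1) skew_vec_def delta_def)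
  with v(2) c show ?thesis
    by (simp add: prims_iff comult_coords_skew_vec del: comult_coords.simps)
qed

lemma skew_primitive_classification:
  assumes q: "\<And>n. n > 0 \<Longrightarrow> q ^ n \<noteq> 1"
  shows prims_same: "prims q m m = {\<zero>\<^bsub>Uq q\<^esub>}"
    and prims_far: "n - m \<noteq> 0 \<Longrightarrow> n - m \<noteq> 1 \<Longrightarrow>
      prims q m n = cline q (kpow q m \<ominus>\<^bsub>Uq q\<^esub> kpow q n)"
    and prims_0_1: "prims q 0 1 = cline q (ugen q Ge) <+>\<^bsub>Uq q\<^esub> cline q f_k <+>\<^bsub>Uq q\<^esub> cline q k_1"
    and prims_near: "n - m = 1 \<Longrightarrow> prims q m n = kpow q m <#\<^bsub>Uq q\<^esub> prims q 0 1"
proof -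
  have iff: "X \<in> prims q m n \<longleftrightarrow> X \<in> carrier (Uq q) \<and> (\<exists>\<alpha> \<beta> \<gamma>. ucoords X = skew_vec m n \<alpha> \<beta> \<gamma> \<and>
      (n \<noteq> m + 1 \<longrightarrow> \<alpha> = 0 \<and> \<beta> = 0))" for X m n
  proof
    assume "X \<in> prims q m n"
    then show "X \<in> carrier (Uq q) \<and> (\<exists>\<alpha> \<beta> \<gamma>. ucoords X = skew_vec m n \<alpha> \<beta> \<gamma> \<and>
        (n \<noteq> m + 1 \<longrightarrow> \<alpha> = 0 \<and> \<beta> = 0))"
      using skew_vec_classification[OF q_nz q, where v = "ucoords X"] unfolding prims_iff by blast
  next
    assume "X \<in> carrier (Uq q) \<and> (\<exists>\<alpha> \<beta> \<gamma>. ucoords X = skew_vec m n \<alpha> \<beta> \<gamma> \<and>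
        (n \<noteq> m + 1 \<longrightarrow> \<alpha> = 0 \<and> \<beta> = 0))"
    then obtain \<alpha> \<beta> \<gamma> where "X \<in> carrier (Uq q)" "ucoords X = skew_vec m n \<alpha> \<beta> \<gamma>"
      "n \<noteq> m + 1 \<longrightarrow> \<alpha> = 0 \<and> \<beta> = 0" by blast
    then show "X \<in> prims q m n"
      by (simp only: prims_iff comult_coords_skew_vec) simp
  qed
  \<comment> \<open>The case n = m is included: k^m - k^n is then 0, so the line is 0 and equal
    indices are settled as well.\<close>
  have far: "X \<in> prims q m n \<longleftrightarrow> X \<in> cline q (kpow q m \<ominus>\<^bsub>Uq q\<^esub> kpow q n)" if "n - m \<noteq> 1" for X m n
  proof -
    have coords: "ucoords (c \<odot>\<^bsub>Uq q\<^esub> (kpow q m \<ominus>\<^bsub>Uq q\<^esub> kpow q n)) = skew_vec m n 0 0 c" for c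
      by (rule ext) (simp add: U.qmap_smult U.qmap_diff skew_vec_def)
    have "X \<in> prims q m n \<longleftrightarrow> X \<in> carrier (Uq q) \<and> (\<exists>c. ucoords X = skew_vec m n 0 0 c)"
      using that by (auto simp: iff)
    also have "\<dots> \<longleftrightarrow> X \<in> cline q (kpow q m \<ominus>\<^bsub>Uq q\<^esub> kpow q n)"
      unfolding cline_eq coords[symmetric]
      using ucoords_eqI[of X] by (metis U.Q.minus_closed U.smult_Q_closed kpow_carrier)
    finally show ?thesis .
  qed
  show "n - m \<noteq> 0 \<Longrightarrow> n - m \<noteq> 1 \<Longrightarrow> prims q m n = cline q (kpow q m \<ominus>\<^bsub>Uq q\<^esub> kpow q n)"
    using far by blast
  have "c \<odot>\<^bsub>Uq q\<^esub> (kpow q m \<ominus>\<^bsub>Uq q\<^esub> kpow q m) = \<zero>\<^bsub>Uq q\<^esub>" for c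
    by (rule ucoords_eqI) (auto simp: U.qmap_smult U.qmap_diff)
  then have "cline q (kpow q m \<ominus>\<^bsub>Uq q\<^esub> kpow q m) = {\<zero>\<^bsub>Uq q\<^esub>}"
    by (auto simp: cline_eq)
  then show "prims q m m = {\<zero>\<^bsub>Uq q\<^esub>}"
    using far[of m m] by auto
  have prims_comb: "X \<in> prims q 0 1 \<longleftrightarrow> (\<exists>a b c. X = a \<odot>\<^bsub>Uq q\<^esub> ugen q Ge \<oplus>\<^bsub>Uq q\<^esub> b \<odot>\<^bsub>Uq q\<^esub> f_k
      \<oplus>\<^bsub>Uq q\<^esub> c \<odot>\<^bsub>Uq q\<^esub> k_1)" for X
  proof
    assume "X \<in> prims q 0 1"
    then obtain \<alpha> \<beta> \<gamma> where c: "X \<in> carrier (Uq q)" and "ucoords X = skew_vec 0 1 \<alpha> \<beta> \<gamma>"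
      by (auto simp: iff)
    then have "ucoords X = skew_vec 0 1 \<alpha> (q * (\<beta> / q)) (- (- \<gamma>))"
      using q_nz by simp
    then have "X = \<alpha> \<odot>\<^bsub>Uq q\<^esub> ugen q Ge \<oplus>\<^bsub>Uq q\<^esub> (\<beta> / q) \<odot>\<^bsub>Uq q\<^esub> f_k \<oplus>\<^bsub>Uq q\<^esub> (- \<gamma>) \<odot>\<^bsub>Uq q\<^esub> k_1"
      unfolding ucoords_linear_combination[symmetric] by (intro ucoords_eqI c) simp_all
    then show "\<exists>a b c. X = a \<odot>\<^bsub>Uq q\<^esub> ugen q Ge \<oplus>\<^bsub>Uq q\<^esub> b \<odot>\<^bsub>Uq q\<^esub> f_k \<oplus>\<^bsub>Uq q\<^esub> c \<odot>\<^bsub>Uq q\<^esub> k_1"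
      by blast
  next
    assume "\<exists>a b c. X = a \<odot>\<^bsub>Uq q\<^esub> ugen q Ge \<oplus>\<^bsub>Uq q\<^esub> b \<odot>\<^bsub>Uq q\<^esub> f_k \<oplus>\<^bsub>Uq q\<^esub> c \<odot>\<^bsub>Uq q\<^esub> k_1"
    then obtain a b c where X: "X = a \<odot>\<^bsub>Uq q\<^esub> ugen q Ge \<oplus>\<^bsub>Uq q\<^esub> b \<odot>\<^bsub>Uq q\<^esub> f_k \<oplus>\<^bsub>Uq q\<^esub> c \<odot>\<^bsub>Uq q\<^esub> k_1"
      by blast
    have "ucoords X = skew_vec 0 1 a (q * b) (- c)"
      unfolding X by (rule ucoords_linear_combination)
    moreover have "X \<in> carrier (Uq q)"
      by (simp add: X)
    ultimately show "X \<in> prims q 0 1"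
      unfolding iff by auto
  qed
  have cline_comb: "X \<in> cline q (ugen q Ge) <+>\<^bsub>Uq q\<^esub> cline q f_k <+>\<^bsub>Uq q\<^esub> cline q k_1 \<longleftrightarrow>
    (\<exists>a b c. X = a \<odot>\<^bsub>Uq q\<^esub> ugen q Ge \<oplus>\<^bsub>Uq q\<^esub> b \<odot>\<^bsub>Uq q\<^esub> f_k \<oplus>\<^bsub>Uq q\<^esub> c \<odot>\<^bsub>Uq q\<^esub> k_1)" for X
    unfolding set_add_def' cline_def by blast
  show "prims q 0 1 = cline q (ugen q Ge) <+>\<^bsub>Uq q\<^esub> cline q f_k <+>\<^bsub>Uq q\<^esub> cline q k_1"
    by (rule Set.set_eqI) (rule trans[OF prims_comb cline_comb[symmetric]])
  show "prims q m n = kpow q m <#\<^bsub>Uq q\<^esub> prims q 0 1" if "n - m = 1"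
  proof (intro equalityI subsetI)
    fix X assume X: "X \<in> prims q m n"
    \<comment> \<open>As k^m is invertible, X is k^m times its shift by -m, which lies in P(0,
      1).\<close>
    then have "X = kpow q m \<otimes>\<^bsub>Uq q\<^esub> (kpow q (- m) \<otimes>\<^bsub>Uq q\<^esub> X)"
      using prims_carrier[OF X] by (simp add: kpow_mult kpow_0 flip: U.m_assoc)
    moreover have "kpow q (- m) \<otimes>\<^bsub>Uq q\<^esub> X \<in> prims q 0 1"
      using prims_shift[OF q X, of "- m"] that by simp
    ultimately show "X \<in> kpow q m <#\<^bsub>Uq q\<^esub> prims q 0 1"
      by (auto simp: l_coset_def)
  next
    fix X assume "X \<in> kpow q m <#\<^bsub>Uq q\<^esub> prims q 0 1"
    then obtain Y where "Y \<in> prims q 0 1" "X = kpow q m \<otimes>\<^bsub>Uq q\<^esub> Y"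
      by (auto simp: l_coset_def)
    with prims_shift[OF q this(1), of m] that show "X \<in> prims q m n"
      by (simp add: algebra_simps)
  qed
qed

end

theorem proposition3p1:
  fixes q :: complex
  assumes "q \<noteq> 0" and "\<forall>n::nat. n > 0 \<longrightarrow> q ^ n \<noteq> 1"
  shows "{g. grouplike q g} = range (kpow q)
    \<and> (\<forall>m n. m = n \<longrightarrow> prims q m n = {\<zero>\<^bsub>Uq q\<^esub>})
    \<and> (\<forall>m n. n - m \<noteq> 0 \<and> n - m \<noteq> 1 \<longrightarrow>
          prims q m n = cline q (kpow q m \<ominus>\<^bsub>Uq q\<^esub> kpow q n))
    \<and> (prims q 0 1 =
          cline q (ugen q Ge)
            <+>\<^bsub>Uq q\<^esub> cline q (ugen q Gf \<otimes>\<^bsub>Uq q\<^esub> ugen q Gk)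
            <+>\<^bsub>Uq q\<^esub> cline q (ugen q Gk \<ominus>\<^bsub>Uq q\<^esub> \<one>\<^bsub>Uq q\<^esub>)
        \<and> (\<forall>a b c. a \<odot>\<^bsub>Uq q\<^esub> ugen q Ge
            \<oplus>\<^bsub>Uq q\<^esub> b \<odot>\<^bsub>Uq q\<^esub> (ugen q Gf \<otimes>\<^bsub>Uq q\<^esub> ugen q Gk)
            \<oplus>\<^bsub>Uq q\<^esub> c \<odot>\<^bsub>Uq q\<^esub> (ugen q Gk \<ominus>\<^bsub>Uq q\<^esub> \<one>\<^bsub>Uq q\<^esub>) = \<zero>\<^bsub>Uq q\<^esub>
            \<longrightarrow> a = 0 \<and> b = 0 \<and> c = 0))
    \<and> (\<forall>m n. n - m = 1 \<longrightarrow> prims q m n = kpow q m <#\<^bsub>Uq q\<^esub> prims q 0 1)"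
proof -
  interpret osp q by unfold_locales (rule assms(1))
  have q: "q ^ n \<noteq> 1" if "n > 0" for n :: nat
    using assms(2) that by blast
  show ?thesis
  proof (intro conjI allI impI)
    show "{g. grouplike q g} = range (kpow q)"
      using grouplike_iff by blast
    show "prims q m n = {\<zero>\<^bsub>Uq q\<^esub>}" if "m = n" for m n
      using prims_same[OF q] that by simp
    show "prims q m n = cline q (kpow q m \<ominus>\<^bsub>Uq q\<^esub> kpow q n)"
      if "n - m \<noteq> 0 \<and> n - m \<noteq> 1" for m n
      using prims_far[OF q] that by blast
    show "prims q 0 1 = cline q (ugen q Ge) <+>\<^bsub>Uq q\<^esub> cline q f_k <+>\<^bsub>Uq q\<^esub> cline q k_1"
      by (rule prims_0_1[OF q])
    show "prims q m n = kpow q m <#\<^bsub>Uq q\<^esub> prims q 0 1" if "n - m = 1" for m n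
      using prims_near[OF q that] .
  qed (use linear_independence in blast)+
qed

end
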